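(* Let $K\ge 2$ and let $\pi=(p_1,\dots,p_K)$ be a probability vector with $p_1>p_2\ge p_3\ge\cdots\ge p_K>0$ and $\sum_{k=1}^K p_k=1$. Answers $a^{(1)},a^{(2)},\dots$ are drawn i.i.d. from $\pi$ over $K$ unlabeled answers $a_1,\dots,a_K$. For $L\in\{2,\dots,K\}$ and $\delta\in(0,1/2)$, let $n^{\star,L}=n^{\star,L}(\delta):=\inf\{n\ge 1:\ \mathbb{P}(H_1\mid \mathcal{C}_n^L)\ge 1-\delta\}$, where $\mathbb{P}(H_1\mid\mathcal{C}_n^L)$ is the $L$-aggregated posterior defined in the context. Then: (i) for $L=2$, $$\lim_{\delta\to 0}\frac{\mathbb{E}[n^{\star,2}]}{\log(1/\delta)}=\frac{1}{\mathrm{D}_{\mathrm{KL}}(p_1\,\|\,p_2)},$$ where $\mathrm{D}_{\mathrm{KL}}(p_1\|p_2)=p_1\log\frac{p_1}{p_2}+(1-p_1)\log\frac{1-p_1}{1-p_2}$ is the KL divergence between $\mathrm{Bern}(p_1)$ and $\mathrm{Bern}(p_2)$; (ii) for every $L\in\{3,4,\dots,K\}$, $$\lim_{\delta\to 0}\frac{\mathbb{E}[n^{\star,L}]}{\log(1/\delta)}=\frac{1}{(p_1-p_2)\log\frac{p_1}{p_2}}.$$ The expectation is with respect to the i.i.d. sampling from $\pi$.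
   Context: Observation model: the labels of the answers are not observed; only which samples are identical. After $n$ samples let $M(n)$ be the number of distinct answers observed and $n_1\ge n_2\ge\cdots\ge n_{M(n)}\ge1$ their occurrence counts (so $\sum_j n_j=n$). For $L\in\{2,\dots,K\}$ set $L(n):=\min\{L-1,M(n)\}$, $v_d:=n_{L(n)}$, $c'_d:=\#\{j\le L(n): n_j=v_d\}$, and $\bar n:=n-\sum_{i=1}^{L(n)}n_i$. The $L$-aggregated state $\mathcal{C}_n^L$ consists of $n$ and the top counts $(n_1,\dots,n_{L(n)})$. For an injective map $\psi:\{1,\dots,L(n)\}\to\{1,\dots,K\}$, let $J_\psi=\{1,\dots,K\}\setminus\psi(\{1,\dots,L(n)\})$ and $$\tilde S_\psi:=\sum_{\mathbf r} w(\mathbf r)\,\frac{\bar n!}{\prod_{j\in J_\psi} r_j!}\prod_{j\in J_\psi}p_j^{r_j},$$ the sum over all $\mathbf r=(r_j)_{j\in J_\psi}$ with $r_j\in\{0,1,\dots,v_d\}$ and $\sum_{j\in J_\psi}r_j=\bar n$, where $w(\mathbf r):=\binom{c'_d+m(\mathbf r)}{c'_d}^{-1}$ and $m(\mathbf r):=\#\{j\in J_\psi: r_j=v_d\}$. The $L$-aggregated posterior is $$\mathbb{P}(H_1\mid\mathcal{C}_n^L):=\frac{\sum_{\psi:\ \psi(1)=1}\big(\prod_{j=1}^{L(n)}p_{\psi(j)}^{n_j}\big)\tilde S_\psi}{\sum_{\psi}\big(\prod_{j=1}^{L(n)}p_{\psi(j)}^{n_j}\big)\tilde S_\psi},$$ with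 sums over injective maps $\psi:\{1,\dots,L(n)\}\to\{1,\dots,K\}$; it is the approximate posterior probability that the most frequently observed answer is the true mode $a_1$ (hypothesis $H_1$). The stopping rule stops at the first $n$ where this exceeds $1-\delta$ and outputs the most frequent observed answer. *)

theory Defs
  imports "HOL-Probability.Probability"
begin

text \<open>Answers are labelled 1..K; answer k has probability p k.\<close>
definition answer_pmf :: "nat \<Rightarrow> (nat \<Rightarrow> real) \<Rightarrow> nat pmf" where
  "answer_pmf K p = embed_pmf (\<lambda>k. if k \<in> {1..K} then p k else 0)"

text \<open>i.i.d. sampling: omega i is the (i+1)-th sampled answer.\<close>
definition sample_space :: "nat \<Rightarrow> (nat \<Rightarrow> real) \<Rightarrow> (nat \<Rightarrow> nat) measure" where
  "sample_space K p = PiM UNIV (\<lambda>_::nat. measure_pmf (answer_pmf K p))"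

text \<open>number of occurrences of answer k among the first n samples\<close>
definition occ :: "(nat \<Rightarrow> nat) \<Rightarrow> nat \<Rightarrow> nat \<Rightarrow> nat" where
  "occ \<omega> n k = card {i. i < n \<and> \<omega> i = k}"

text \<open>occurrence counts of the distinct observed answers, in non-increasing order
  (n_1 >= n_2 >= ... >= n_M); only identity of samples is used, not labels.\<close>
definition top_counts :: "(nat \<Rightarrow> nat) \<Rightarrow> nat \<Rightarrow> nat list" where
  "top_counts \<omega> n = rev (sort (map (occ \<omega> n) (sorted_list_of_set (\<omega> ` {..<n}))))"

text \<open>L-aggregated posterior P(H_1 | C_n^L), given n and the sorted counts cs
  (cs ! (j-1) = n_j, length cs = M(n)).\<close>
definition agg_posterior :: "nat \<Rightarrow> (nat \<Rightarrow> real) \<Rightarrow> nat \<Rightarrow> nat \<Rightarrow> nat list \<Rightarrow> real" where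
  "agg_posterior K p L n cs = (let
     M = length cs;
     Ln = min (L - 1) M;
     nj = (\<lambda>j. cs ! (j - 1));
     v = nj Ln;
     c = card {j \<in> {1..Ln}. nj j = v};
     nbar = n - (\<Sum>i=1..Ln. nj i);
     Psi = {\<psi> \<in> {1..Ln} \<rightarrow>\<^sub>E {1..K}. inj_on \<psi> {1..Ln}};
     St = (\<lambda>\<psi>. let J = {1..K} - \<psi> ` {1..Ln} in
        \<Sum>r \<in> {r \<in> J \<rightarrow>\<^sub>E {0..v}. (\<Sum>j\<in>J. r j) = nbar}.
          (1 / real ((c + card {j \<in> J. r j = v}) choose c))
          * (fact nbar / (\<Prod>j\<in>J. fact (r j)))
          * (\<Prod>j\<in>J. p j ^ r j));
     tm = (\<lambda>\<psi>. (\<Prod>j=1..Ln. p (\<psi> j) ^ nj j) * St \<psi>)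
   in (\<Sum>\<psi> \<in> {\<psi> \<in> Psi. \<psi> 1 = 1}. tm \<psi>) / (\<Sum>\<psi> \<in> Psi. tm \<psi>))"

text \<open>n^{*,L}(delta) = inf {n >= 1. posterior >= 1 - delta} (infinity if empty)\<close>
definition stop_time :: "nat \<Rightarrow> (nat \<Rightarrow> real) \<Rightarrow> nat \<Rightarrow> real \<Rightarrow> (nat \<Rightarrow> nat) \<Rightarrow> ennreal" where
  "stop_time K p L \<delta> \<omega> =
     (if \<exists>n\<ge>1. agg_posterior K p L n (top_counts \<omega> n) \<ge> 1 - \<delta>
      then of_nat (LEAST n. n \<ge> 1 \<and> agg_posterior K p L n (top_counts \<omega> n) \<ge> 1 - \<delta>)
      else \<infinity>)"

definition expected_stop :: "nat \<Rightarrow> (nat \<Rightarrow> real) \<Rightarrow> nat \<Rightarrow> real \<Rightarrow> ennreal" where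
  "expected_stop K p L \<delta> = (\<integral>\<^sup>+ \<omega>. stop_time K p L \<delta> \<omega> \<partial>(sample_space K p))"

definition KL_bern :: "real \<Rightarrow> real \<Rightarrow> real" where
  "KL_bern a b = a * ln (a / b) + (1 - a) * ln ((1 - a) / (1 - b))"

end

theory Submission
  imports Defs
begin

text \<open>
  Let \<open>A\<^sub>k\<close> be the part of the normalising sum with \<open>\<psi>(1) = k\<close>, so that the posterior is
  \<open>A\<^sub>1 / (A\<^sub>1 + B)\<close> with \<open>B = A\<^sub>2 + \<dots> + A\<^sub>K\<close>. Applying the transposition \<open>(i k)\<close> to the labels
  of a configuration multiplies its weight by \<open>(p\<^sub>k / p\<^sub>i) ^ (N\<^sub>i - N\<^sub>k)\<close>, where \<open>N\<close> are the counts,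
  and leaves the combinatorial coefficients unchanged. For \<open>L \<ge> 3\<close> this pins \<open>B / A\<^sub>1\<close> down to
  \<open>(p\<^sub>2 / p\<^sub>1) ^ (n\<^sub>1 - n\<^sub>2)\<close> up to a factor \<open>K\<close>. For \<open>L = 2\<close> it gives \<open>A\<^sub>2 \<le> B \<le> K A\<^sub>2\<close>, and
  the multinomial theorem with a Chernoff bound gives \<open>A\<^sub>i \<approx> p\<^sub>i ^ n\<^sub>1 (1 - p\<^sub>i) ^ (n - n\<^sub>1)\<close> for
  \<open>i = 1, 2\<close> up to constants, as soon as \<open>n\<^sub>1 / n\<close> is close to \<open>p\<^sub>1\<close>.

  In both cases \<open>1 - posterior = exp (- n (D + o(1)))\<close> as long as the empirical frequencies are
  close to \<open>p\<close>. By Hoeffding's inequality the probabilities of the exceptional events are summable,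
  so the expected stopping time exceeds \<open>(1 + \<epsilon>) ln (1/\<delta>) / D\<close> by at most a constant, while
  stopping before \<open>(1 - \<epsilon>) ln (1/\<delta>) / D\<close> has small probability.
\<close>

section \<open>Multinomial sums with capped entries\<close>

text \<open>Extensional functions make each distribution of \<open>N\<close> samples over the labels
  in \<open>J\<close> appear exactly once. With \<open>v = N\<close> the cap is vacuous, so
  \<open>alloc J N N\<close> indexes the full multinomial expansion.\<close>

definition alloc :: "nat set \<Rightarrow> nat \<Rightarrow> nat \<Rightarrow> (nat \<Rightarrow> nat) set" where
  "alloc J v N = {r \<in> J \<rightarrow>\<^sub>E {0..v}. (\<Sum>j\<in>J. r j) = N}"

lemma finite_alloc: "finite J \<Longrightarrow> finite (alloc J v N)"
  unfolding alloc_def by (auto intro!: finite_subset[OF _ finite_PiE[of J "\<lambda>_. {0..v}"]])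

lemma alloc_le_sum:
  assumes "finite J"
  shows "alloc J v N \<subseteq> alloc J N N"
proof
  fix r assume r: "r \<in> alloc J v N"
  have "r j \<le> N" if "j \<in> J" for j
    using r member_le_sum[of j J r] assms that by (auto simp: alloc_def)
  with r show "r \<in> alloc J N N" by (auto simp: alloc_def PiE_iff)
qed

text \<open>Induction on \<open>J\<close>: fixing the entry at the new label leaves an allocation of
  the remaining samples, and the binomial theorem recombines the two parts.\<close>

lemma multinomial_theorem_alloc:
  fixes x :: "nat \<Rightarrow> real"
  assumes "finite J"
  shows "(\<Sum>r\<in>alloc J N N. fact N / (\<Prod>j\<in>J. fact (r j)) * (\<Prod>j\<in>J. x j ^ r j)) = (\<Sum>j\<in>J. x j) ^ N"
proof -
  \<comment> \<open>Dividing by \<open>fact N\<close> turns each summand into a product over labels,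
    which splits when a label is added.\<close>
  have "(\<Sum>r\<in>alloc J N N. (\<Prod>j\<in>J. x j ^ r j / fact (r j))) = (\<Sum>j\<in>J. x j) ^ N / fact N"
    using assms
  proof (induction J arbitrary: N rule: finite_induct)
    case empty
    then show ?case by (cases "N = 0") (auto simp: alloc_def)
  next
    case (insert a J)
    have "(\<Sum>r\<in>alloc (insert a J) N N. (\<Prod>j\<in>insert a J. x j ^ r j / fact (r j)))
       = (\<Sum>(k, r)\<in>(SIGMA k:{..N}. alloc J (N - k) (N - k)).
            x a ^ k / fact k * (\<Prod>j\<in>J. x j ^ r j / fact (r j)))"
    proof (rule sum.reindex_bij_witness[where
          j = "\<lambda>r. (r a, restrict r J)" and i = "\<lambda>(k, r). r(a := k)"])
      fix r assume r: "r \<in> alloc (insert a J) N N"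
      then have s: "r a + (\<Sum>j\<in>J. r j) = N"
        using insert by (simp add: alloc_def)
      have le: "r j \<le> N - r a" if "j \<in> J" for j
        using member_le_sum[of j J r] insert(1) that s by simp
      show "(case (r a, restrict r J) of (k, r) \<Rightarrow> r(a := k)) = r"
        using r by (auto simp: alloc_def fun_eq_iff PiE_iff extensional_def)
      show "(r a, restrict r J) \<in> (SIGMA k:{..N}. alloc J (N - k) (N - k))"
        using s le by (auto simp: alloc_def)
      show "(case (r a, restrict r J) of (k, r) \<Rightarrow> x a ^ k / fact k * (\<Prod>j\<in>J. x j ^ r j / fact (r j)))
            = (\<Prod>j\<in>insert a J. x j ^ r j / fact (r j))"
        using insert by (simp cong: prod.cong)
    next
      fix kr assume kr: "kr \<in> (SIGMA k:{..N}. alloc J (N - k) (N - k))"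
      obtain k r where [simp]: "kr = (k, r)" by (cases kr)
      have eq: "(\<Sum>j\<in>J. if j = a then k else r j) = (\<Sum>j\<in>J. r j)"
        using insert by (intro sum.cong) auto
      show "(\<lambda>r. (r a, restrict r J)) (case kr of (k, r) \<Rightarrow> r(a := k)) = kr"
        using kr insert(2) by (auto simp: alloc_def fun_eq_iff PiE_iff extensional_def)
      have "r j \<le> N" if "j \<in> J" for j
        using kr that by (fastforce simp: alloc_def PiE_iff)
      then show "(case kr of (k, r) \<Rightarrow> r(a := k)) \<in> alloc (insert a J) N N"
        using kr insert eq by (auto simp: alloc_def PiE_iff extensional_def)
    qed
    also have "\<dots> = (\<Sum>k\<le>N. x a ^ k / fact k * (\<Sum>r\<in>alloc J (N - k) (N - k). (\<Prod>j\<in>J. x j ^ r j / fact (r j))))"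
      using insert(1) by (subst sum.Sigma[symmetric]) (auto simp: sum_distrib_left finite_alloc)
    also have "\<dots> = (\<Sum>k\<le>N. x a ^ k / fact k * ((\<Sum>j\<in>J. x j) ^ (N - k) / fact (N - k)))"
      unfolding insert.IH ..
    also have "\<dots> = (\<Sum>k\<le>N. of_nat (N choose k) * x a ^ k * (\<Sum>j\<in>J. x j) ^ (N - k)) / fact N"
      unfolding sum_divide_distrib by (intro sum.cong) (auto simp: binomial_fact field_simps)
    also have "\<dots> = (x a + (\<Sum>j\<in>J. x j)) ^ N / fact N"
      by (simp add: binomial_ring)
    finally show ?case using insert by simp
  qed
  then have "fact N * (\<Sum>r\<in>alloc J N N. (\<Prod>j\<in>J. x j ^ r j / fact (r j))) = (\<Sum>j\<in>J. x j) ^ N"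
    by simp
  then show ?thesis by (simp add: sum_distrib_left prod_dividef)
qed

text \<open>Greedy filling: the new label takes as many samples as its cap permits and the other
  labels absorb the rest.\<close>

lemma alloc_nonempty:
  assumes "finite J" "N \<le> card J * v"
  shows "alloc J v N \<noteq> {}"
  using assms
proof (induction J arbitrary: N rule: finite_induct)
  case empty
  then show ?case by (simp add: alloc_def)
next
  case (insert a J)
  define k where "k = min v N"
  have "N - k \<le> card J * v"
    using insert by (auto simp: k_def min_def)
  then obtain r where r: "r \<in> alloc J v (N - k)"
    using insert.IH by blast
  have eq: "(\<Sum>j\<in>J. if j = a then k else r j) = (\<Sum>j\<in>J. r j)"
    using insert by (intro sum.cong) auto
  have "r(a := k) \<in> alloc (insert a J) v N"
    using r eq insert(1,2) by (auto simp: alloc_def PiE_iff extensional_def) (auto simp: k_def)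
  then show ?case by blast
qed

text \<open>Tie weight times multinomial coefficient: the part of a summand of
  \<open>S\<^sub>\<psi>\<close> that is free of the probabilities, hence the part that relabelling
  preserves.\<close>

definition coef :: "nat \<Rightarrow> nat \<Rightarrow> nat \<Rightarrow> nat set \<Rightarrow> (nat \<Rightarrow> nat) \<Rightarrow> real" where
  "coef c v N J r = 1 / real ((c + card {j \<in> J. r j = v}) choose c) * (fact N / (\<Prod>j\<in>J. fact (r j)))"

lemma coef_pos: "coef c v N J r > 0"
  unfolding coef_def by (auto intro!: mult_pos_pos divide_pos_pos prod_pos)

lemma coef_le: "coef c v N J r \<le> fact N / (\<Prod>j\<in>J. fact (r j))"
proof -
  have "1 / real ((c + card {j \<in> J. r j = v}) choose c) \<le> 1"
    by (simp add: Suc_leI)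
  then show ?thesis unfolding coef_def
    by (intro mult_left_le_one_le) (auto intro!: divide_nonneg_pos prod_pos)
qed

text \<open>This is \<open>S\<^sub>\<psi>\<close> for \<open>J = J\<^sub>\<psi>\<close>.\<close>
definition free_sum :: "(nat \<Rightarrow> real) \<Rightarrow> nat \<Rightarrow> nat \<Rightarrow> nat \<Rightarrow> nat set \<Rightarrow> real" where
  "free_sum q c v N J = (\<Sum>r\<in>alloc J v N. coef c v N J r * (\<Prod>j\<in>J. q j ^ r j))"

text \<open>Tie weights are at most 1 and lifting the cap adds nonnegative terms; the multinomial
  theorem then evaluates the sum.\<close>

lemma free_sum_le:
  assumes "finite J" "\<And>j. j \<in> J \<Longrightarrow> q j > 0"
  shows "free_sum q c v N J \<le> (\<Sum>j\<in>J. q j) ^ N"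
proof -
  have "free_sum q c v N J \<le> (\<Sum>r\<in>alloc J v N. fact N / (\<Prod>j\<in>J. fact (r j)) * (\<Prod>j\<in>J. q j ^ r j))"
    unfolding free_sum_def
    by (intro sum_mono mult_right_mono coef_le prod_nonneg) (simp add: assms(2) less_imp_le)
  also have "\<dots> \<le> (\<Sum>r\<in>alloc J N N. fact N / (\<Prod>j\<in>J. fact (r j)) * (\<Prod>j\<in>J. q j ^ r j))"
    by (intro sum_mono2 finite_alloc alloc_le_sum mult_nonneg_nonneg divide_nonneg_nonneg prod_nonneg)
       (simp_all add: assms less_imp_le)
  finally show ?thesis unfolding multinomial_theorem_alloc[OF assms(1)] .
qed

text \<open>Chernoff's bound: an allocation with \<open>r j > v\<close> is charged the factor \<open>\<theta> ^ (r j) / \<theta> ^ v \<ge> 1\<close>.\<close>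
lemma free_sum_ge:
  assumes J: "finite J" "\<And>j. j \<in> J \<Longrightarrow> q j > 0" and \<theta>: "\<theta> \<ge> 1"
  shows "real (Suc (card J)) * free_sum q 1 v N J \<ge>
     (\<Sum>j\<in>J. q j) ^ N - (\<Sum>j\<in>J. ((\<Sum>i\<in>J. q i) + (\<theta> - 1) * q j) ^ N / \<theta> ^ v)"
proof -
  define m where "m r = fact N / (\<Prod>j\<in>J. fact (r j)) * (\<Prod>j\<in>J. q j ^ r j)" for r :: "nat \<Rightarrow> nat"
  have m0: "m r \<ge> 0" for r
    unfolding m_def
    by (intro mult_nonneg_nonneg divide_nonneg_nonneg prod_nonneg) (simp_all add: J(2) less_imp_le)
  \<comment> \<open>The factor \<open>\<theta> ^ r j\<close> is absorbed by replacing
    \<open>q j\<close> with \<open>\<theta> * q j\<close>, so the tilted sum is again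
    multinomial.\<close>
  have tilt: "(\<Sum>r\<in>alloc J N N. m r * \<theta> ^ r j / \<theta> ^ v) = ((\<Sum>i\<in>J. q i) + (\<theta> - 1) * q j) ^ N / \<theta> ^ v"
    if j: "j \<in> J" for j
  proof -
    let ?x = "\<lambda>i. if i = j then \<theta> * q i else q i"
    have *: "m r * \<theta> ^ r j = fact N / (\<Prod>j\<in>J. fact (r j)) * (\<Prod>i\<in>J. ?x i ^ r i)" for r
    proof -
      have "(\<Prod>i\<in>J. ?x i ^ r i) = (\<Prod>i\<in>J. (if i = j then \<theta> ^ r i else 1) * q i ^ r i)"
        by (intro prod.cong) (auto simp: power_mult_distrib)
      also have "\<dots> = \<theta> ^ r j * (\<Prod>i\<in>J. q i ^ r i)"
        using J j by (simp add: prod.distrib prod.delta)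
      finally show ?thesis by (simp add: m_def)
    qed
    have "(\<Sum>i\<in>J. ?x i) = (\<Sum>i\<in>J. q i + (if i = j then (\<theta> - 1) * q i else 0))"
      by (intro sum.cong) (auto simp: algebra_simps)
    also have "\<dots> = (\<Sum>i\<in>J. q i) + (\<theta> - 1) * q j"
      using J j by (simp add: sum.distrib)
    finally show ?thesis
      unfolding sum_divide_distrib[symmetric] * multinomial_theorem_alloc[OF J(1)] by simp
  qed
  \<comment> \<open>Outside the cap some coordinate exceeds \<open>v\<close>, and the tilted term of
    that coordinate alone is at least \<open>m r\<close>.\<close>
  have charge: "m r \<le> (if r \<in> alloc J v N then m r else 0) + (\<Sum>j\<in>J. m r * \<theta> ^ r j / \<theta> ^ v)"
    if r: "r \<in> alloc J N N" for r
  proof (cases "r \<in> alloc J v N")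
    case True
    then show ?thesis using m0 \<theta> by (auto intro!: sum_nonneg divide_nonneg_nonneg mult_nonneg_nonneg)
  next
    case False
    then obtain j where j: "j \<in> J" "r j > v"
      using r by (auto simp: alloc_def PiE_iff not_le)
    have "m r * 1 \<le> m r * (\<theta> ^ r j / \<theta> ^ v)"
      using j \<theta> by (intro mult_left_mono m0) (simp add: power_increasing)
    also have "\<dots> \<le> (\<Sum>j\<in>J. m r * (\<theta> ^ r j / \<theta> ^ v))"
      using j J \<theta> m0 by (intro member_le_sum) (auto intro!: mult_nonneg_nonneg)
    finally show ?thesis using False by simp
  qed
  have "(\<Sum>j\<in>J. q j) ^ N = (\<Sum>r\<in>alloc J N N. m r)"
    unfolding m_def multinomial_theorem_alloc[OF J(1)] ..
  also have "\<dots> \<le> (\<Sum>r\<in>alloc J N N. (if r \<in> alloc J v N then m r else 0) + (\<Sum>j\<in>J. m r * \<theta> ^ r j / \<theta> ^ v))"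
    by (intro sum_mono charge)
  also have "\<dots> = (\<Sum>r\<in>alloc J v N. m r) + (\<Sum>j\<in>J. ((\<Sum>i\<in>J. q i) + (\<theta> - 1) * q j) ^ N / \<theta> ^ v)"
  proof -
    have "(\<Sum>r\<in>alloc J N N. if r \<in> alloc J v N then m r else 0) = (\<Sum>r\<in>alloc J v N. m r)"
      using alloc_le_sum[OF J(1), of v N]
      by (subst sum.inter_restrict[symmetric]) (auto intro: finite_alloc J simp: Int_absorb1)
    then show ?thesis
      by (simp add: sum.distrib tilt sum.swap[of _ J])
  qed
  also have "(\<Sum>r\<in>alloc J v N. m r) \<le> real (Suc (card J)) * free_sum q 1 v N J"
    unfolding free_sum_def sum_distrib_left
  proof (rule sum_mono)
    fix r
    \<comment> \<open>For \<open>c = 1\<close> the tie weight is 1 over 1 plus the number of ties;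
      there are at most \<open>card J\<close> ties, whence the factor
      \<open>Suc (card J)\<close>.\<close>
    have "card {j \<in> J. r j = v} \<le> card J"
      using J by (intro card_mono) auto
    then have "1 \<le> real (Suc (card J)) * (1 / real ((1 + card {j \<in> J. r j = v}) choose 1))"
      by (simp add: field_simps)
    then have "1 * m r \<le> real (Suc (card J)) * (1 / real ((1 + card {j \<in> J. r j = v}) choose 1)) * m r"
      by (intro mult_right_mono m0)
    then show "m r \<le> real (Suc (card J)) * (coef 1 v N J r * (\<Prod>j\<in>J. q j ^ r j))"
      by (simp add: m_def coef_def mult_ac)
  qed
  finally show ?thesis by simp
qed

text \<open>Carrying allocations along the transposition preserves the multinomial coefficient and
  the number of ties, so only the probabilities are permuted.\<close>

lemma free_sum_transpose:
  "free_sum q c v N (Transposition.transpose i k ` J) = free_sum (q \<circ> Transposition.transpose i k) c v N J"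
proof -
  let ?t = "Transposition.transpose i k"
  have prodt: "(\<Prod>j\<in>?t ` J. f j) = (\<Prod>j\<in>J. f (?t j))" for f :: "nat \<Rightarrow> real"
    by (subst prod.reindex) (auto intro: inj_on_subset[OF inj_transpose])
  have sumt: "(\<Sum>j\<in>?t ` J. f j) = (\<Sum>j\<in>J. f (?t j))" for f :: "nat \<Rightarrow> nat"
    by (subst sum.reindex) (auto intro: inj_on_subset[OF inj_transpose])
  have cardt: "card {j \<in> ?t ` J. P j} = card {j \<in> J. P (?t j)}" for P
  proof -
    have "{j \<in> ?t ` J. P j} = ?t ` {j \<in> J. P (?t j)}" by auto
    then show ?thesis by (simp add: card_image inj_on_subset[OF inj_transpose])
  qed
  show ?thesis unfolding free_sum_def
  proof (rule sum.reindex_bij_witness[where j = "\<lambda>r. restrict (r \<circ> ?t) J" and i = "\<lambda>r. restrict (r \<circ> ?t) (?t ` J)"])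
    fix r assume r: "r \<in> alloc (?t ` J) v N"
    show "restrict (restrict (r \<circ> ?t) J \<circ> ?t) (?t ` J) = r"
      using r by (auto simp: alloc_def fun_eq_iff PiE_iff extensional_def restrict_def)
    show "restrict (r \<circ> ?t) J \<in> alloc J v N"
      using r by (auto simp: alloc_def sumt cong: sum.cong)
    show "coef c v N J (restrict (r \<circ> ?t) J) * (\<Prod>j\<in>J. (q \<circ> ?t) j ^ restrict (r \<circ> ?t) J j)
        = coef c v N (?t ` J) r * (\<Prod>j\<in>?t ` J. q j ^ r j)"
      by (simp add: coef_def prodt cardt cong: prod.cong conj_cong)
  next
    fix r assume r: "r \<in> alloc J v N"
    show "restrict (restrict (r \<circ> ?t) (?t ` J) \<circ> ?t) J = r"
      using r by (auto simp: alloc_def fun_eq_iff PiE_iff extensional_def restrict_def)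
    show "restrict (r \<circ> ?t) (?t ` J) \<in> alloc (?t ` J) v N"
      using r by (auto simp: alloc_def sumt cong: sum.cong)
  qed
qed

text \<open>Only the factors at \<open>i\<close> and \<open>k\<close> change, from
  \<open>q i ^ f i * q k ^ f k\<close> to \<open>q k ^ f i * q i ^ f k\<close>. The order of
  \<open>f i\<close> and \<open>f k\<close> lets natural subtraction express the exponent.\<close>

lemma prod_transpose_power:
  fixes q :: "nat \<Rightarrow> real" and f :: "nat \<Rightarrow> nat"
  assumes S: "finite S" "i \<in> S" "k \<in> S" "i \<noteq> k" and q: "q i > 0" "q k > 0" and f: "f k \<le> f i"
  shows "(\<Prod>m\<in>S. (q \<circ> Transposition.transpose i k) m ^ f m) = (q k / q i) ^ (f i - f k) * (\<Prod>m\<in>S. q m ^ f m)"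
proof -
  have split: "(\<Prod>m\<in>S. g m) = g i * (g k * (\<Prod>m\<in>S - {i, k}. g m))" for g :: "nat \<Rightarrow> real"
  proof -
    have "(\<Prod>m\<in>S. g m) = g i * (\<Prod>m\<in>S - {i}. g m)"
      using S by (simp add: prod.remove)
    also have "(\<Prod>m\<in>S - {i}. g m) = g k * (\<Prod>m\<in>S - {i} - {k}. g m)"
      using S by (intro prod.remove) auto
    also have "S - {i} - {k} = S - {i, k}" by auto
    finally show ?thesis .
  qed
  have rest: "(\<Prod>m\<in>S - {i, k}. (q \<circ> Transposition.transpose i k) m ^ f m) = (\<Prod>m\<in>S - {i, k}. q m ^ f m)"
    by (intro prod.cong) (auto simp: Transposition.transpose_def)
  obtain d where d: "f i = f k + d" using f le_Suc_ex by blast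
  show ?thesis
    unfolding split[of "\<lambda>m. (q \<circ> Transposition.transpose i k) m ^ f m"] split[of "\<lambda>m. q m ^ f m"] rest
    using q by (simp add: d power_add power_divide)
qed


section \<open>Relabelling by transpositions\<close>

text \<open>Here \<open>l\<close> is \<open>L(n)\<close>, \<open>nj j\<close> the
  \<open>j\<close>-th largest count (indexed from 1), \<open>c\<close> the number of top counts tied
  with the smallest one, and \<open>N\<close> the number of samples outside the top counts.
  Relabelling keeps all of them fixed.\<close>

locale agg_state =
  fixes K l v c N :: nat and p :: "nat \<Rightarrow> real" and nj :: "nat \<Rightarrow> nat"
  assumes K2: "K \<ge> 2"
    and l: "1 \<le> l" "l \<le> K"
    and p_pos: "\<And>k. k \<in> {1..K} \<Longrightarrow> p k > 0"
    and p12: "p 1 > p 2"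
    and p_decr: "\<And>i j. 2 \<le> i \<Longrightarrow> i \<le> j \<Longrightarrow> j \<le> K \<Longrightarrow> p j \<le> p i"
    and nj_decr: "\<And>i j. 1 \<le> i \<Longrightarrow> i \<le> j \<Longrightarrow> j \<le> l \<Longrightarrow> nj j \<le> nj i"
    and v_def: "v = nj l"
begin

definition inj_maps :: "(nat \<Rightarrow> nat) set" where
  "inj_maps = {\<psi> \<in> {1..l} \<rightarrow>\<^sub>E {1..K}. inj_on \<psi> {1..l}}"

definition free :: "(nat \<Rightarrow> nat) \<Rightarrow> nat set" where
  "free \<psi> = {1..K} - \<psi> ` {1..l}"

definition tm :: "(nat \<Rightarrow> real) \<Rightarrow> (nat \<Rightarrow> nat) \<Rightarrow> real" where
  "tm q \<psi> = (\<Prod>j=1..l. q (\<psi> j) ^ nj j) * free_sum q c v N (free \<psi>)"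

text \<open>\<open>restrict\<close> keeps the result in the extensional function space, so that
  swapping twice is the identity on \<open>inj_maps\<close>.\<close>

definition swap_map :: "nat \<Rightarrow> nat \<Rightarrow> (nat \<Rightarrow> nat) \<Rightarrow> nat \<Rightarrow> nat" where
  "swap_map i k \<psi> = restrict (Transposition.transpose i k \<circ> \<psi>) {1..l}"

text \<open>The count vector of a full configuration: labels hit by \<open>\<psi>\<close> receive a
  top count, free labels receive their entry of \<open>r\<close>. It treats observed and free labels
  alike.\<close>

definition cnt :: "(nat \<Rightarrow> nat) \<Rightarrow> (nat \<Rightarrow> nat) \<Rightarrow> nat \<Rightarrow> nat" where
  "cnt \<psi> r m = (if m \<in> \<psi> ` {1..l} then nj (inv_into {1..l} \<psi> m) else r m)"

text \<open>This is \<open>A\<^sub>k\<close>, the unnormalised weight of the hypothesis that the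
  most frequent answer carries label \<open>k\<close>.\<close>

definition mass :: "nat \<Rightarrow> real" where
  "mass k = (\<Sum>\<psi>\<in>{\<psi> \<in> inj_maps. \<psi> 1 = k}. tm p \<psi>)"

section \<open>Label swaps acting on configurations\<close>

lemma finite_inj_maps: "finite inj_maps"
  unfolding inj_maps_def by (rule finite_subset[OF _ finite_PiE[of "{1..l}" "\<lambda>_. {1..K}"]]) auto

lemma finite_free [simp]: "finite (free \<psi>)"
  by (simp add: free_def)

lemma inj_maps_range: "\<psi> \<in> inj_maps \<Longrightarrow> j \<in> {1..l} \<Longrightarrow> \<psi> j \<in> {1..K}"
  by (auto simp: inj_maps_def PiE_iff)

lemma inj_maps_inj: "\<psi> \<in> inj_maps \<Longrightarrow> inj_on \<psi> {1..l}"
  by (simp add: inj_maps_def)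

lemma transpose_labels: "i \<in> {1..K} \<Longrightarrow> k \<in> {1..K} \<Longrightarrow> Transposition.transpose i k ` {1..K} = {1..K}"
  by (rule transpose_image_eq) blast

lemma swap_map_in:
  assumes "\<psi> \<in> inj_maps" "i \<in> {1..K}" "k \<in> {1..K}"
  shows "swap_map i k \<psi> \<in> inj_maps"
proof -
  have "inj_on (swap_map i k \<psi>) {1..l}"
    unfolding swap_map_def inj_on_restrict_eq
    by (intro comp_inj_on inj_maps_inj assms inj_on_subset[OF inj_transpose]) simp
  moreover have "swap_map i k \<psi> \<in> {1..l} \<rightarrow>\<^sub>E {1..K}"
    unfolding swap_map_def restrict_PiE_iff comp_apply
    using inj_maps_range[OF assms(1)] transpose_labels[OF assms(2,3)] by blast
  ultimately show ?thesis
    unfolding inj_maps_def by blast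
qed

lemma swap_map_swap_map: "\<psi> \<in> inj_maps \<Longrightarrow> swap_map i k (swap_map i k \<psi>) = \<psi>"
proof
  fix x assume "\<psi> \<in> inj_maps"
  then have "\<psi> \<in> {1..l} \<rightarrow>\<^sub>E {1..K}" by (simp add: inj_maps_def)
  then have "\<psi> x = undefined" if "x \<notin> {1..l}" using that by (rule PiE_arb)
  then show "swap_map i k (swap_map i k \<psi>) x = \<psi> x"
    by (cases "x \<in> {1..l}") (simp_all add: swap_map_def)
qed

lemma swap_map_apply: "j \<in> {1..l} \<Longrightarrow> swap_map i k \<psi> j = Transposition.transpose i k (\<psi> j)"
  by (simp add: swap_map_def)

lemma free_swap_map:
  assumes "i \<in> {1..K}" "k \<in> {1..K}"
  shows "free (swap_map i k \<psi>) = Transposition.transpose i k ` free \<psi>"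
proof -
  have "swap_map i k \<psi> ` {1..l} = Transposition.transpose i k ` \<psi> ` {1..l}"
    unfolding swap_map_def by (simp only: image_restrict_eq image_comp)
  then show ?thesis
    unfolding free_def image_set_diff[OF inj_transpose] transpose_labels[OF assms] by simp
qed

text \<open>The swap moves from the map onto the probability vector, after which both weights are
  sums over the same allocations.\<close>

lemma tm_swap_map:
  assumes "i \<in> {1..K}" "k \<in> {1..K}"
  shows "tm q (swap_map i k \<psi>) = tm (q \<circ> Transposition.transpose i k) \<psi>"
proof -
  have "(\<Prod>j=1..l. q (swap_map i k \<psi> j) ^ nj j) = (\<Prod>j=1..l. (q \<circ> Transposition.transpose i k) (\<psi> j) ^ nj j)"
    by (intro prod.cong) (simp_all add: swap_map_apply)
  then show ?thesis
    unfolding tm_def free_swap_map[OF assms] free_sum_transpose by simp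
qed

text \<open>With all labels in one product, a transposition of probabilities acts in the same way
  whether the two labels are observed or free.\<close>

lemma tm_eq_sum_cnt:
  assumes \<psi>: "\<psi> \<in> inj_maps"
  shows "tm q \<psi> = (\<Sum>r\<in>alloc (free \<psi>) v N. coef c v N (free \<psi>) r * (\<Prod>m\<in>{1..K}. q m ^ cnt \<psi> r m))"
proof -
  have inj: "inj_on \<psi> {1..l}" and sub: "\<psi> ` {1..l} \<subseteq> {1..K}"
    using \<psi> by (auto simp: inj_maps_def PiE_iff)
  have "(\<Prod>m\<in>{1..K}. q m ^ cnt \<psi> r m) = (\<Prod>j=1..l. q (\<psi> j) ^ nj j) * (\<Prod>j\<in>free \<psi>. q j ^ r j)" for r
  proof -
    have "(\<Prod>m\<in>{1..K}. q m ^ cnt \<psi> r m)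
        = (\<Prod>m\<in>free \<psi>. q m ^ cnt \<psi> r m) * (\<Prod>m\<in>\<psi> ` {1..l}. q m ^ cnt \<psi> r m)"
      unfolding free_def by (rule prod.subset_diff[OF sub]) simp
    also have "(\<Prod>m\<in>\<psi> ` {1..l}. q m ^ cnt \<psi> r m) = (\<Prod>j=1..l. q (\<psi> j) ^ nj j)"
      unfolding prod.reindex[OF inj]
      using inv_into_f_f[OF inj] by (intro prod.cong) (simp_all add: cnt_def)
    also have "(\<Prod>m\<in>free \<psi>. q m ^ cnt \<psi> r m) = (\<Prod>j\<in>free \<psi>. q j ^ r j)"
      by (intro prod.cong) (auto simp: cnt_def free_def)
    finally show ?thesis by simp
  qed
  then show ?thesis
    unfolding tm_def free_sum_def sum_distrib_left by (intro sum.cong) auto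
qed

lemma cnt_at: "\<psi> \<in> inj_maps \<Longrightarrow> a \<in> {1..l} \<Longrightarrow> cnt \<psi> r (\<psi> a) = nj a"
  unfolding cnt_def using inv_into_f_f[OF inj_maps_inj, of \<psi> a] by simp

text \<open>The swap multiplies each configuration by \<open>p k / p i\<close> raised to the
  difference of the two counts. This ratio is at most 1, so a lower bound \<open>d\<close> and an
  upper bound \<open>e\<close> on the exponent bound the whole weight from above and from
  below.\<close>

lemma tm_swap_map_bounds:
  assumes \<psi>: "\<psi> \<in> inj_maps" and a: "a \<in> {1..l}" "\<psi> a = i"
    and k: "k \<in> {1..K}" "k \<noteq> i" "p k \<le> p i"
    and le: "\<And>r. r \<in> alloc (free \<psi>) v N \<Longrightarrow> cnt \<psi> r k \<le> nj a"
    and d: "\<And>r. r \<in> alloc (free \<psi>) v N \<Longrightarrow> d \<le> nj a - cnt \<psi> r k \<and> nj a - cnt \<psi> r k \<le> e"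
  shows "tm p (swap_map i k \<psi>) \<le> (p k / p i) ^ d * tm p \<psi>"
    and "(p k / p i) ^ e * tm p \<psi> \<le> tm p (swap_map i k \<psi>)"
proof -
  have i: "i \<in> {1..K}" using inj_maps_range[OF \<psi> a(1)] a(2) by simp
  have pp: "p i > 0" "p k > 0" using p_pos i k by auto
  let ?c = "\<lambda>r. coef c v N (free \<psi>) r" and ?P = "\<lambda>r. (\<Prod>m\<in>{1..K}. p m ^ cnt \<psi> r m)"
  have eq: "tm p (swap_map i k \<psi>) =
      (\<Sum>r\<in>alloc (free \<psi>) v N. (p k / p i) ^ (nj a - cnt \<psi> r k) * (?c r * ?P r))"
    unfolding tm_swap_map[OF i k(1)] tm_eq_sum_cnt[OF \<psi>]
  proof (rule sum.cong[OF refl])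
    fix r assume r: "r \<in> alloc (free \<psi>) v N"
    have ci: "cnt \<psi> r i = nj a" using cnt_at[OF \<psi> a(1)] a(2) by simp
    have "(\<Prod>m = 1..K. (p \<circ> Transposition.transpose i k) m ^ cnt \<psi> r m) = (p k / p i) ^ (nj a - cnt \<psi> r k) * ?P r"
      using prod_transpose_power[of "{1..K}" i k p "cnt \<psi> r"] i k pp le[OF r] ci by simp
    then show "?c r * (\<Prod>m = 1..K. (p \<circ> Transposition.transpose i k) m ^ cnt \<psi> r m)
        = (p k / p i) ^ (nj a - cnt \<psi> r k) * (?c r * ?P r)" by simp
  qed
  have nonneg: "?c r * ?P r \<ge> 0" for r
    by (intro mult_nonneg_nonneg prod_nonneg zero_le_power less_imp_le[OF coef_pos])
       (simp add: p_pos less_imp_le)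
  have ratio: "0 \<le> p k / p i" "p k / p i \<le> 1" using pp k by auto
  show "tm p (swap_map i k \<psi>) \<le> (p k / p i) ^ d * tm p \<psi>"
    unfolding eq tm_eq_sum_cnt[OF \<psi>, of p] sum_distrib_left
    using d ratio by (intro sum_mono mult_right_mono nonneg power_decreasing) auto
  show "(p k / p i) ^ e * tm p \<psi> \<le> tm p (swap_map i k \<psi>)"
    unfolding eq tm_eq_sum_cnt[OF \<psi>, of p] sum_distrib_left
    using d ratio by (intro sum_mono mult_right_mono nonneg power_decreasing) auto
qed

lemma tm_nonneg: "\<psi> \<in> inj_maps \<Longrightarrow> tm p \<psi> \<ge> 0"
  unfolding tm_eq_sum_cnt[of _ p]
  by (intro sum_nonneg mult_nonneg_nonneg prod_nonneg zero_le_power less_imp_le[OF coef_pos])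
     (simp add: p_pos less_imp_le)

text \<open>Such a label is either the image of an index from \<open>b\<close> on, or free and hence
  capped by \<open>v\<close>, the smallest top count.\<close>

lemma cnt_le:
  assumes \<psi>: "\<psi> \<in> inj_maps" and r: "r \<in> alloc (free \<psi>) v N" and m: "m \<in> {1..K}"
    and b: "b \<in> {1..l}" and ne: "\<And>j. 1 \<le> j \<Longrightarrow> j < b \<Longrightarrow> \<psi> j \<noteq> m"
  shows "cnt \<psi> r m \<le> nj b"
proof (cases "m \<in> \<psi> ` {1..l}")
  case True
  then obtain j where j: "j \<in> {1..l}" "m = \<psi> j" by auto
  then have "b \<le> j" using ne[of j] by (auto simp: not_less[symmetric])
  then show ?thesis using j cnt_at[OF \<psi>, of j r] nj_decr[of b j] b by auto
next
  case False
  then have "m \<in> free \<psi>" using m by (simp add: free_def)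
  then have "r m \<le> v" using r by (auto simp: alloc_def)
  also have "v \<le> nj b" using b by (auto simp: v_def intro: nj_decr)
  finally show ?thesis using False by (simp add: cnt_def)
qed

text \<open>\<open>swap_map i k\<close> is an involution of \<open>inj_maps\<close>, hence a valid
  reindexing.\<close>

lemma sum_swap_map:
  assumes "i \<in> {1..K}" "k \<in> {1..K}"
    and "\<And>\<psi>. \<psi> \<in> inj_maps \<Longrightarrow> Q (swap_map i k \<psi>) \<longleftrightarrow> R \<psi>"
  shows "(\<Sum>\<psi>\<in>{\<psi> \<in> inj_maps. Q \<psi>}. f \<psi>) = (\<Sum>\<psi>\<in>{\<psi> \<in> inj_maps. R \<psi>}. f (swap_map i k \<psi>))"
proof -
  have "R (swap_map i k \<psi>) \<longleftrightarrow> Q \<psi>" if "\<psi> \<in> inj_maps" for \<psi>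
    using assms(3)[OF swap_map_in[OF that assms(1,2)]] swap_map_swap_map[OF that] by simp
  then show ?thesis
    by (intro sum.reindex_bij_witness[where i = "swap_map i k" and j = "swap_map i k"])
       (simp_all add: assms(3) swap_map_in[OF _ assms(1,2)] swap_map_swap_map)
qed

section \<open>Comparison of the masses of the hypotheses\<close>

lemma mass_eq_swap:
  assumes "i \<in> {1..K}" "k \<in> {1..K}"
  shows "mass k = (\<Sum>\<psi>\<in>{\<psi> \<in> inj_maps. \<psi> 1 = i}. tm p (swap_map i k \<psi>))"
  unfolding mass_def using l
  by (intro sum_swap_map assms) (auto simp: swap_map_apply Transposition.transpose_def)

lemma mass_nonneg: "mass k \<ge> 0"
  unfolding mass_def by (auto intro!: sum_nonneg tm_nonneg)

lemma p_le_2: "k \<in> {2..K} \<Longrightarrow> p k \<le> p 2"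
  using p_decr[of 2 k] by auto

lemma label_1: "1 \<in> {1..K}" and label_2: "2 \<in> {1..K}"
  using K2 by auto

text \<open>Swap labels 1 and \<open>k\<close>. Since \<open>s\<close> bounds the count of
  \<open>k\<close> whenever label 1 is on top, every exponent is at least \<open>nj 1 - s\<close>;
  then \<open>p k\<close> is raised to \<open>p 2\<close>.\<close>

lemma mass_le_mass_1:
  assumes k: "k \<in> {2..K}" and s: "s \<le> nj 1"
    and cnt: "\<And>\<psi> r. \<psi> \<in> inj_maps \<Longrightarrow> \<psi> 1 = 1 \<Longrightarrow> r \<in> alloc (free \<psi>) v N \<Longrightarrow> cnt \<psi> r k \<le> s"
  shows "mass k \<le> (p 2 / p 1) ^ (nj 1 - s) * mass 1"
proof -
  have k': "k \<in> {1..K}" "k \<noteq> 1" using k by auto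
  have pp: "p 1 > 0" "p 2 > 0" "p k > 0" using p_pos k' label_1 label_2 by blast+
  have pk: "p k \<le> p 2" "p k \<le> p 1" using p_le_2[OF k] p12 by auto
  have "tm p (swap_map 1 k \<psi>) \<le> (p 2 / p 1) ^ (nj 1 - s) * tm p \<psi>"
    if \<psi>: "\<psi> \<in> inj_maps" "\<psi> 1 = 1" for \<psi>
  proof -
    have "cnt \<psi> r k \<le> nj 1" "nj 1 - s \<le> nj 1 - cnt \<psi> r k \<and> nj 1 - cnt \<psi> r k \<le> nj 1"
      if "r \<in> alloc (free \<psi>) v N" for r
      using cnt[OF \<psi> that] s by auto
    then have "tm p (swap_map 1 k \<psi>) \<le> (p k / p 1) ^ (nj 1 - s) * tm p \<psi>"
      using l by (intro tm_swap_map_bounds(1)[OF \<psi>(1) _ \<psi>(2) k' pk(2), where e = "nj 1"]) auto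
    also have "\<dots> \<le> (p 2 / p 1) ^ (nj 1 - s) * tm p \<psi>"
      using pp pk by (intro mult_right_mono power_mono divide_right_mono tm_nonneg[OF \<psi>(1)]) auto
    finally show ?thesis .
  qed
  then show ?thesis
    unfolding mass_eq_swap[OF label_1 k'(1)] mass_def[of 1] sum_distrib_left by (intro sum_mono) auto
qed

text \<open>Swapping labels 1 and 2 gives exponents of at most \<open>nj 1\<close>. This is crude
  but valid for every \<open>l\<close>.\<close>

lemma mass_2_ge: "(p 2 / p 1) ^ nj 1 * mass 1 \<le> mass 2"
proof -
  have "(p 2 / p 1) ^ nj 1 * tm p \<psi> \<le> tm p (swap_map 1 2 \<psi>)"
    if \<psi>: "\<psi> \<in> inj_maps" "\<psi> 1 = 1" for \<psi>
    using l p12 label_2 cnt_le[OF \<psi>(1) _ label_2, of _ 1]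
    by (intro tm_swap_map_bounds(2)[OF \<psi>(1) _ \<psi>(2), where d = 0]) auto
  then show ?thesis
    unfolding mass_eq_swap[OF label_1 label_2] mass_def[of 1] sum_distrib_left by (intro sum_mono) auto
qed

text \<open>With label 2 on top, swapping it with the less probable label \<open>k\<close> cannot
  increase any weight.\<close>

lemma mass_le_mass_2:
  assumes k: "k \<in> {2..K}"
  shows "mass k \<le> mass 2"
proof (cases "k = 2")
  case False
  have k': "k \<in> {1..K}" using k by auto
  have "tm p (swap_map 2 k \<psi>) \<le> tm p \<psi>" if \<psi>: "\<psi> \<in> inj_maps" "\<psi> 1 = 2" for \<psi>
    using tm_swap_map_bounds(1)[OF \<psi>(1) _ \<psi>(2) k' False p_le_2[OF k], where d = 0 and e = "nj 1"]
      l cnt_le[OF \<psi>(1) _ k', of _ 1] by auto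
  then show ?thesis
    unfolding mass_eq_swap[OF label_2 k'] mass_def[of 2] by (intro sum_mono) auto
qed simp

text \<open>Among the configurations with label 1 on top, those with label 2 in second place carry
  at least a share \<open>1 / K\<close> of the mass. On these, swapping labels 1 and 2 costs exactly
  the gap between the two largest counts.\<close>

lemma mass_2_ge_gap:
  assumes l2: "l \<ge> 2"
  shows "(p 2 / p 1) ^ (nj 1 - nj 2) * mass 1 \<le> real K * mass 2"
proof -
  \<comment> \<open>The mass with label 1 on top and label \<open>k\<close> in second place;
    swapping 2 and \<open>k\<close> shows that \<open>k = 2\<close> is the heaviest part.\<close>
  define part where "part k = (\<Sum>\<psi>\<in>{\<psi> \<in> inj_maps. \<psi> 1 = 1 \<and> \<psi> 2 = k}. tm p \<psi>)" for k
  have pp: "p 1 > 0" "p 2 > 0" using p_pos label_1 label_2 by blast+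
  have part_le: "part k \<le> part 2" if k: "k \<in> {2..K}" for k
  proof (cases "k = 2")
    case False
    have k': "k \<in> {1..K}" using k by auto
    have eq: "part k = (\<Sum>\<psi>\<in>{\<psi> \<in> inj_maps. \<psi> 1 = 1 \<and> \<psi> 2 = 2}. tm p (swap_map 2 k \<psi>))"
      unfolding part_def using l2 k
      by (intro sum_swap_map label_2 k') (auto simp: swap_map_apply Transposition.transpose_def)
    have "tm p (swap_map 2 k \<psi>) \<le> tm p \<psi>" if \<psi>: "\<psi> \<in> inj_maps" "\<psi> 1 = 1" "\<psi> 2 = 2" for \<psi>
    proof -
      have "cnt \<psi> r k \<le> nj 2" if "r \<in> alloc (free \<psi>) v N" for r
      proof (rule cnt_le[OF \<psi>(1) that k'])
        fix j :: nat assume "1 \<le> j" "j < 2"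
        then have "j = 1" by simp
        then show "\<psi> j \<noteq> k" using \<psi>(2) k by simp
      qed (use l2 in simp)
      then show ?thesis
        using tm_swap_map_bounds(1)[OF \<psi>(1) _ \<psi>(3) k' False p_le_2[OF k], where d = 0 and e = "nj 2"] l2
        by auto
    qed
    then show ?thesis
      unfolding eq part_def[of 2] by (intro sum_mono) auto
  qed simp
  have "mass 1 = (\<Sum>k\<in>{2..K}. part k)"
  proof -
    have "\<psi> 2 \<in> {2..K}" if "\<psi> \<in> inj_maps" "\<psi> 1 = 1" for \<psi>
    proof -
      have "\<psi> 2 \<noteq> \<psi> 1" using inj_onD[OF inj_maps_inj[OF that(1)], of 2 1] l2 by auto
      then show ?thesis using inj_maps_range[OF that(1), of 2] l2 that by auto
    qed
    then have "(\<Sum>k\<in>{2..K}. sum (tm p) {\<psi> \<in> {\<psi> \<in> inj_maps. \<psi> 1 = 1}. \<psi> 2 = k}) = mass 1"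
      unfolding mass_def using finite_inj_maps by (intro sum.group) auto
    then show ?thesis by (simp add: part_def conj_ac)
  qed
  also have "\<dots> \<le> (\<Sum>k\<in>{2..K}. part 2)" by (intro sum_mono part_le)
  also have "\<dots> \<le> real K * part 2"
    by (auto intro!: mult_right_mono sum_nonneg tm_nonneg simp: part_def)
  finally have "(p 2 / p 1) ^ (nj 1 - nj 2) * mass 1 \<le> (p 2 / p 1) ^ (nj 1 - nj 2) * (real K * part 2)"
    using pp by (intro mult_left_mono) auto
  also have "\<dots> = real K * ((p 2 / p 1) ^ (nj 1 - nj 2) * part 2)" by simp
  also have "\<dots> \<le> real K * mass 2"
  proof (intro mult_left_mono)
    \<comment> \<open>Because \<open>\<psi> 2 = 2\<close>, the count of label 2 is
      \<open>nj 2\<close> in every allocation, so the exponent is constant.\<close>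
    have "(p 2 / p 1) ^ (nj 1 - nj 2) * tm p \<psi> \<le> tm p (swap_map 1 2 \<psi>)"
      if \<psi>: "\<psi> \<in> inj_maps" "\<psi> 1 = 1" "\<psi> 2 = 2" for \<psi>
      using cnt_at[OF \<psi>(1), of 2] \<psi>(3) l2 p12 label_2 nj_decr[of 1 2]
      by (intro tm_swap_map_bounds(2)[OF \<psi>(1) _ \<psi>(2), where d = 0]) auto
    then have "(p 2 / p 1) ^ (nj 1 - nj 2) * part 2
        \<le> (\<Sum>\<psi>\<in>{\<psi> \<in> inj_maps. \<psi> 1 = 1 \<and> \<psi> 2 = 2}. tm p (swap_map 1 2 \<psi>))"
      unfolding part_def sum_distrib_left by (intro sum_mono) auto
    also have "\<dots> \<le> mass 2"
      unfolding mass_eq_swap[OF label_1 label_2] using finite_inj_maps label_1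
      by (intro sum_mono2) (auto intro!: tm_nonneg swap_map_in label_2)
    finally show "(p 2 / p 1) ^ (nj 1 - nj 2) * part 2 \<le> mass 2" .
  qed simp
  finally show ?thesis .
qed

lemma sum_tm_eq: "(\<Sum>\<psi>\<in>inj_maps. tm p \<psi>) = mass 1 + (\<Sum>k\<in>{2..K}. mass k)"
proof -
  have "(\<Sum>\<psi>\<in>inj_maps. tm p \<psi>) = (\<Sum>k\<in>{1..K}. mass k)"
    unfolding mass_def using finite_inj_maps inj_maps_range[of _ 1] l
    by (intro sum.group[symmetric]) auto
  also have "{1..K} = insert 1 {2..K}" using K2 by auto
  finally show ?thesis by simp
qed

lemma rest_ge: "mass 2 \<le> (\<Sum>k\<in>{2..K}. mass k)"
  using K2 mass_nonneg by (intro member_le_sum) auto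

text \<open>The hypothesis says that the free labels have room for \<open>N\<close> samples, so the
  identity assignment has positive weight. This makes the posterior a genuine quotient.\<close>

lemma mass_1_pos:
  assumes "N \<le> (K - l) * v"
  shows "mass 1 > 0"
proof -
  define \<psi>' where "\<psi>' = restrict id {1..l}"
  have \<psi>: "\<psi>' \<in> inj_maps" using l by (auto simp: \<psi>'_def inj_maps_def inj_on_def)
  have psi1: "\<psi>' 1 = 1" using l by (simp add: \<psi>'_def)
  have "free \<psi>' = {l<..K}" by (auto simp: free_def \<psi>'_def)
  then have "alloc (free \<psi>') v N \<noteq> {}" using assms by (intro alloc_nonempty) auto
  then have "tm p \<psi>' > 0"
    unfolding tm_eq_sum_cnt[OF \<psi>]
    by (intro sum_pos mult_pos_pos coef_pos prod_pos finite_alloc) (simp_all add: p_pos)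
  also have "tm p \<psi>' \<le> mass 1"
    unfolding mass_def using \<psi> finite_inj_maps psi1 by (intro member_le_sum) (auto intro: tm_nonneg)
  finally show ?thesis .
qed

text \<open>For \<open>l = 1\<close> the map is determined by its value at 1; this is the situation
  for \<open>L = 2\<close>.\<close>

lemma mass_single:
  assumes "l = 1" "k \<in> {1..K}"
  shows "mass k = p k ^ nj 1 * free_sum p c v N ({1..K} - {k})"
proof -
  have "{\<psi> \<in> inj_maps. \<psi> 1 = k} = {restrict (\<lambda>_. k) {1}}"
    unfolding inj_maps_def using assms by (auto simp: PiE_iff extensional_def fun_eq_iff)
  then show ?thesis unfolding mass_def tm_def free_def using assms by simp
qed

end

text \<open>The local definitions mirror the \<open>let\<close> bindings of
  \<open>agg_posterior\<close>; grouping the denominator by \<open>\<psi> 1\<close> produces the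
  masses.\<close>

lemma agg_posterior_eq:
  fixes K L n cs p
  defines "l \<equiv> min (L - 1) (length cs)"
  defines "v \<equiv> cs ! (l - 1)"
  defines "c \<equiv> card {j \<in> {1..l}. cs ! (j - 1) = v}"
  defines "N \<equiv> n - (\<Sum>i=1..l. cs ! (i - 1))"
  assumes "agg_state K l v p (\<lambda>j. cs ! (j - 1))"
  defines "A \<equiv> agg_state.mass K l v c N p (\<lambda>j. cs ! (j - 1))"
  shows "agg_posterior K p L n cs = A 1 / (A 1 + (\<Sum>k\<in>{2..K}. A k))"
proof -
  interpret agg_state K l v c N p "\<lambda>j. cs ! (j - 1)" by fact
  show ?thesis
    unfolding A_def sum_tm_eq[symmetric]
    unfolding agg_posterior_def Let_def mass_def tm_def free_sum_def coef_def alloc_def free_def inj_maps_def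
      l_def[symmetric] v_def[symmetric] c_def[symmetric] N_def[symmetric] mult.assoc ..
qed

section \<open>Expected first passage times and deviations of the counts\<close>

text \<open>Upper bound: after a deterministic time \<open>m\<close> every index without stopping is
  a bad one, and the expected number of bad indices is finite. Lower bound: with probability near 1
  no late index is bad, while \<open>early\<close> excludes crossings at the finitely many remaining
  indices once \<open>\<delta>\<close> is small. \<open>T\<close> is compared pointwise with
  measurable functions.\<close>

lemma (in prob_space) first_passage_limit:
  fixes X :: "nat \<Rightarrow> 'a \<Rightarrow> real" and T :: "real \<Rightarrow> 'a \<Rightarrow> ennreal" and D :: real
  assumes D: "D > 0"
    and T: "\<And>\<delta> \<omega>. T \<delta> \<omega> = (if \<exists>n\<ge>1. X n \<omega> \<ge> 1 - \<delta> then of_nat (LEAST n. n \<ge> 1 \<and> X n \<omega> \<ge> 1 - \<delta>) else \<infinity>)"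
    and typical: "\<And>\<epsilon>. \<epsilon> > 0 \<Longrightarrow> \<exists>B n0. (\<forall>n. B n \<in> events) \<and> summable (\<lambda>n. prob (B n)) \<and>
      (AE \<omega> in M. \<forall>n\<ge>n0. \<omega> \<notin> B n \<longrightarrow>
          1 - exp (- real n * (D - \<epsilon>)) \<le> X n \<omega> \<and> X n \<omega> \<le> 1 - exp (- real n * (D + \<epsilon>)))"
    and early: "\<And>n. n \<ge> 1 \<Longrightarrow> \<exists>a>0. AE \<omega> in M. X n \<omega> \<le> 1 - a"
  shows "((\<lambda>\<delta>. (\<integral>\<^sup>+ \<omega>. T \<delta> \<omega> \<partial>M) / ennreal (ln (1 / \<delta>))) \<longlongrightarrow> ennreal (1 / D)) (at_right 0)"
proof -
  let ?f = "\<lambda>\<delta>. (\<integral>\<^sup>+ \<omega>. T \<delta> \<omega> \<partial>M) / ennreal (ln (1 / \<delta>))"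
  have small: "\<forall>\<^sub>F \<delta> in at_right 0. 0 < \<delta> \<and> \<delta> < (a::real)" if "a > 0" for a
    using that by (auto simp: eventually_at_right_field intro!: exI[of _ a])
  have upper: "\<forall>\<^sub>F \<delta> in at_right 0. ?f \<delta> < ennreal c" if c: "c > 1 / D" for c
  proof -
    \<comment> \<open>The midpoint leaves a slack \<open>c - c'\<close> that absorbs the additive
      constants when \<open>\<delta>\<close> is small.\<close>
    define c' where "c' = (1 / D + c) / 2"
    have c': "1 / D < c'" "c' < c" "c' > 0" using c D by (auto simp: c'_def field_simps add_pos_pos)
    \<comment> \<open>This choice gives \<open>exp (- n * (D - \<epsilon>)) \<le> \<delta>\<close>
      as soon as \<open>n \<ge> c' * ln (1 / \<delta>)\<close>.\<close>
    define \<epsilon> where "\<epsilon> = D - 1 / c'"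
    have \<epsilon>: "\<epsilon> > 0" "D - \<epsilon> = 1 / c'" using c' D by (auto simp: \<epsilon>_def field_simps)
    obtain B n0 where B: "\<And>n. B n \<in> events" "summable (\<lambda>n. prob (B n))"
      and X: "AE \<omega> in M. \<forall>n\<ge>n0. \<omega> \<notin> B n \<longrightarrow>
          1 - exp (- real n * (D - \<epsilon>)) \<le> X n \<omega> \<and> X n \<omega> \<le> 1 - exp (- real n * (D + \<epsilon>))"
      using typical[OF \<epsilon>(1)] by blast
    define C where "C = (\<Sum>n. prob (B n))"
    have C: "(\<Sum>n. emeasure M (B n)) = ennreal C" "C \<ge> 0"
      unfolding C_def using B(2)
      by (auto simp: emeasure_eq_measure suminf_ennreal2 intro!: suminf_nonneg)
    have bound: "?f \<delta> \<le> ennreal ((real n0 + 2 + c' * ln (1 / \<delta>) + C) / ln (1 / \<delta>))"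
      if \<delta>: "0 < \<delta>" "\<delta> < 1" for \<delta>
    proof -
      have ln_pos: "ln (1 / \<delta>) > 0" using \<delta> by simp
      define m where "m = n0 + 1 + nat \<lceil>c' * ln (1 / \<delta>)\<rceil>"
      have m: "m \<ge> n0" "m \<ge> 1" "real m \<ge> c' * ln (1 / \<delta>)" "real m \<le> real n0 + 2 + c' * ln (1 / \<delta>)"
      proof -
        have "c' * ln (1 / \<delta>) > 0" using c'(3) ln_pos by simp
        then show "real m \<ge> c' * ln (1 / \<delta>)" "real m \<le> real n0 + 2 + c' * ln (1 / \<delta>)"
          unfolding m_def of_nat_add by linarith+
      qed (simp_all add: m_def)
      have "AE \<omega> in M. T \<delta> \<omega> \<le> of_nat m + (\<Sum>n. indicator (B n) \<omega>)"
        using X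
      proof eventually_elim
        case (elim \<omega>)
        have inB: "\<omega> \<in> B n" if n: "n \<ge> m" "X n \<omega> < 1 - \<delta>" for n
        proof (rule ccontr)
          assume "\<omega> \<notin> B n"
          then have "1 - exp (- real n * (D - \<epsilon>)) \<le> X n \<omega>" using elim n m by auto
          moreover have "exp (- real n * (D - \<epsilon>)) \<le> \<delta>"
          proof -
            have "c' * ln (1 / \<delta>) \<le> real n" using m(3) n(1) by linarith
            then have "ln (1 / \<delta>) \<le> real n * (D - \<epsilon>)" using c' by (simp add: \<epsilon>(2) field_simps)
            then have "- real n * (D - \<epsilon>) \<le> ln \<delta>" using \<delta> by (simp add: ln_div)
            then have "exp (- real n * (D - \<epsilon>)) \<le> exp (ln \<delta>)" by (simp only: exp_le_cancel_iff)
            then show ?thesis using \<delta> by simp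
          qed
          ultimately show False using n(2) by linarith
        qed
        \<comment> \<open>The indices from \<open>m\<close> up to \<open>k\<close> without a
          crossing are all bad, so their number is at most the total number of bad indices.\<close>
        have partial: "of_nat (k - m) \<le> (\<Sum>n. indicator (B n) \<omega> :: ennreal)"
          if k: "\<And>n. m \<le> n \<Longrightarrow> n < k \<Longrightarrow> X n \<omega> < 1 - \<delta>" for k
        proof -
          have "of_nat (k - m) = (\<Sum>n\<in>{m..<k}. 1 :: ennreal)" by simp
          also have "\<dots> = (\<Sum>n\<in>{m..<k}. indicator (B n) \<omega>)"
            using inB k by (intro sum.cong) auto
          also have "\<dots> \<le> (\<Sum>n. indicator (B n) \<omega>)" by (intro sum_le_suminf) auto
          finally show ?thesis .
        qed
        show ?case
        proof (cases "\<exists>n\<ge>1. X n \<omega> \<ge> 1 - \<delta>")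
          case True
          define k where "k = (LEAST n. n \<ge> 1 \<and> X n \<omega> \<ge> 1 - \<delta>)"
          have "X n \<omega> < 1 - \<delta>" if "m \<le> n" "n < k" for n
            using not_less_Least[of n "\<lambda>n. n \<ge> 1 \<and> X n \<omega> \<ge> 1 - \<delta>"] that m unfolding k_def by auto
          then have "of_nat (k - m) \<le> (\<Sum>n. indicator (B n) \<omega> :: ennreal)" by (intro partial)
          moreover have "T \<delta> \<omega> = of_nat k" using True by (simp add: T k_def)
          moreover have "(of_nat k :: ennreal) \<le> of_nat m + of_nat (k - m)"
            by (simp flip: of_nat_add)
          ultimately show ?thesis by (metis add_left_mono order_trans)
        next
          case False
          \<comment> \<open>A path that never stops is bad at every index from \<open>m\<close> on,
            so the right-hand side is infinite as well.\<close>
          have "of_nat k \<le> (\<Sum>n. indicator (B n) \<omega> :: ennreal)" for k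
          proof -
            have "X n \<omega> < 1 - \<delta>" if "m \<le> n" for n
              using False m(2) that by (meson le_trans not_le)
            then show ?thesis using partial[of "m + k"] by simp
          qed
          then have "(\<Sum>n. indicator (B n) \<omega> :: ennreal) = \<infinity>"
            using ennreal_Ex_less_of_nat[of "\<Sum>n. indicator (B n) \<omega> :: ennreal"]
            by (auto simp: less_top[symmetric] not_less[symmetric])
          then show ?thesis by simp
        qed
      qed
      then have "(\<integral>\<^sup>+ \<omega>. T \<delta> \<omega> \<partial>M) \<le> (\<integral>\<^sup>+ \<omega>. of_nat m + (\<Sum>n. indicator (B n) \<omega>) \<partial>M)"
        by (rule nn_integral_mono_AE)
      also have "\<dots> = of_nat m + ennreal C"
        using B(1) by (simp add: nn_integral_add nn_integral_suminf emeasure_space_1 C(1))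
      also have "\<dots> = ennreal (real m + C)" using C by (simp add: ennreal_plus ennreal_of_nat_eq_real_of_nat)
      also have "\<dots> \<le> ennreal (real n0 + 2 + c' * ln (1 / \<delta>) + C)" using m by (intro ennreal_leI) auto
      finally have "?f \<delta> \<le> ennreal (real n0 + 2 + c' * ln (1 / \<delta>) + C) / ennreal (ln (1 / \<delta>))"
        by (rule divide_right_mono_ennreal)
      also have "\<dots> = ennreal ((real n0 + 2 + c' * ln (1 / \<delta>) + C) / ln (1 / \<delta>))"
        using C c' ln_pos by (intro divide_ennreal) auto
      finally show ?thesis .
    qed
    \<comment> \<open>\<open>\<delta> < a\<close> says precisely that
      \<open>(c - c') * ln (1 / \<delta>)\<close> exceeds the additive constants.\<close>
    define a where "a = exp (- ((real n0 + 2 + C) / (c - c')))"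
    have "a > 0" by (simp add: a_def)
    have "\<forall>\<^sub>F \<delta> in at_right 0. 0 < \<delta> \<and> \<delta> < min 1 a"
      using \<open>a > 0\<close> by (intro small) auto
    then show ?thesis
    proof eventually_elim
      case (elim \<delta>)
      then have ln_pos: "ln (1 / \<delta>) > 0" by simp
      have "ln \<delta> < ln a" using elim by simp
      then have "(real n0 + 2 + C) / (c - c') < ln (1 / \<delta>)" using elim by (simp add: a_def ln_div)
      then have "(real n0 + 2 + c' * ln (1 / \<delta>) + C) / ln (1 / \<delta>) < c"
        using c' ln_pos by (simp add: field_simps)
      moreover have "0 \<le> (real n0 + 2 + c' * ln (1 / \<delta>) + C) / ln (1 / \<delta>)"
        using c' ln_pos C by (intro divide_nonneg_nonneg add_nonneg_nonneg mult_nonneg_nonneg) auto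
      ultimately have "ennreal ((real n0 + 2 + c' * ln (1 / \<delta>) + C) / ln (1 / \<delta>)) < ennreal c"
        by (simp add: ennreal_less_iff)
      then show ?case using bound[of \<delta>] elim by (meson min_less_iff_conj order.strict_trans1)
    qed
  qed
  have lower: "\<forall>\<^sub>F \<delta> in at_right 0. ennreal c < ?f \<delta>" if c: "0 \<le> c" "c < 1 / D" for c
  proof -
    define c' where "c' = (1 / D + c) / 2"
    have c': "c < c'" "c' < 1 / D" "c' > 0" using c D by (auto simp: c'_def field_simps add_pos_nonneg)
    \<comment> \<open>Now \<open>D + \<epsilon> = 1 / c'\<close>, so typical paths stay below
      \<open>1 - \<delta>\<close> while \<open>n < c' * ln (1 / \<delta>)\<close>.\<close>
    define \<epsilon> where "\<epsilon> = 1 / c' - D"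
    have \<epsilon>: "\<epsilon> > 0" "D + \<epsilon> = 1 / c'" using c' D by (auto simp: \<epsilon>_def field_simps)
    obtain B n0 where B: "\<And>n. B n \<in> events" "summable (\<lambda>n. prob (B n))"
      and X: "AE \<omega> in M. \<forall>n\<ge>n0. \<omega> \<notin> B n \<longrightarrow>
          1 - exp (- real n * (D - \<epsilon>)) \<le> X n \<omega> \<and> X n \<omega> \<le> 1 - exp (- real n * (D + \<epsilon>))"
      using typical[OF \<epsilon>(1)] by blast
    \<comment> \<open>\<open>c' * (1 - \<gamma>)\<close> is the midpoint of \<open>c\<close> and
      \<open>c'\<close>, hence still above \<open>c\<close>.\<close>
    define \<gamma> where "\<gamma> = (1 - c / c') / 2"
    have \<gamma>: "\<gamma> > 0" "\<gamma> < 1" "c < c' * (1 - \<gamma>)" using c c' by (auto simp: \<gamma>_def field_simps)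
    obtain n1' where n1': "\<And>k. k \<ge> n1' \<Longrightarrow> norm (\<Sum>n. prob (B (n + k))) < \<gamma>"
      using suminf_exist_split[OF \<gamma>(1) B(2)] by blast
    define n1 where "n1 = max n0 n1'"
    define U where "U = (\<Union>n. B (n + n1))"
    have U: "U \<in> events" using B by (auto simp: U_def)
    have "prob U \<le> \<gamma>"
    proof -
      have "prob U \<le> (\<Sum>n. prob (B (n + n1)))"
        unfolding U_def using B(1) summable_ignore_initial_segment[OF B(2), of n1]
        by (intro finite_measure_subadditive_countably) auto
      then show ?thesis using n1'[of n1] by (auto simp: n1_def)
    qed
    obtain b where b: "\<And>n. n \<ge> 1 \<Longrightarrow> b n > 0 \<and> (AE \<omega> in M. X n \<omega> \<le> 1 - b n)"
      using early by metis
    \<comment> \<open>Inserting 1 keeps the set nonempty and makes \<open>\<delta> < a\<close> imply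
      \<open>\<delta> < 1\<close>, that is \<open>ln (1 / \<delta>) > 0\<close>.\<close>
    define a where "a = Min (insert 1 (b ` {1..<n1}))"
    have a: "a > 0" "a \<le> 1"
      unfolding a_def using b by (auto simp: Min_gr_iff)
    have ab: "a \<le> b n" if "n \<in> {1..<n1}" for n
      unfolding a_def using that by (intro Min_le) auto
    have Xb: "AE \<omega> in M. \<forall>n\<in>{1..<n1}. X n \<omega> \<le> 1 - b n"
      using b by (intro AE_finite_allI) auto
    have bound: "ennreal (c' * (1 - \<gamma>)) \<le> ?f \<delta>" if \<delta>: "0 < \<delta>" "\<delta> < a" for \<delta>
    proof -
      have ln_pos: "ln (1 / \<delta>) > 0" using \<delta> a by simp
      let ?h = "c' * ln (1 / \<delta>)"
      \<comment> \<open>Outside \<open>U\<close> there is no crossing before \<open>?h\<close>: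
        indices below \<open>n1\<close> are handled by \<open>a\<close>, later ones by the typical
        upper bound.\<close>
      have "AE \<omega> in M. ennreal ?h * indicator (space M - U) \<omega> \<le> T \<delta> \<omega>"
        using X Xb AE_space
      proof eventually_elim
        case (elim \<omega>)
        show ?case
        proof (cases "\<omega> \<in> U")
          case False
          have less: "X n \<omega> < 1 - \<delta>" if n: "n \<ge> 1" "real n < ?h" for n
          proof (cases "n < n1")
            case True
            then have "X n \<omega> \<le> 1 - b n" "a \<le> b n" using elim(2) ab[of n] n by auto
            then show ?thesis using \<delta> by linarith
          next
            case False
            have "\<omega> \<notin> B n"
              using \<open>\<omega> \<notin> U\<close> False unfolding U_def by (auto dest: spec[of _ "n - n1"])
            then have "X n \<omega> \<le> 1 - exp (- real n * (D + \<epsilon>))"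
              using elim(1) False by (auto simp: n1_def)
            moreover have "\<delta> < exp (- real n * (D + \<epsilon>))"
            proof -
              have "real n * (D + \<epsilon>) < ln (1 / \<delta>)" using n(2) c' by (simp add: \<epsilon>(2) field_simps)
              then have "ln \<delta> < - real n * (D + \<epsilon>)" using \<delta> by (simp add: ln_div)
              then have "exp (ln \<delta>) < exp (- real n * (D + \<epsilon>))" by (simp only: exp_less_cancel_iff)
              then show ?thesis using \<delta> by simp
            qed
            ultimately show ?thesis by linarith
          qed
          have "ennreal ?h \<le> T \<delta> \<omega>"
          proof (cases "\<exists>n\<ge>1. X n \<omega> \<ge> 1 - \<delta>")
            case True
            define k where "k = (LEAST n. n \<ge> 1 \<and> X n \<omega> \<ge> 1 - \<delta>)"
            have "k \<ge> 1 \<and> X k \<omega> \<ge> 1 - \<delta>" unfolding k_def by (rule LeastI_ex) (use True in auto)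
            then have "?h \<le> real k" using less[of k] by (meson not_le)
            then have "ennreal ?h \<le> of_nat k" by (simp add: ennreal_of_nat_eq_real_of_nat ennreal_leI)
            then show ?thesis using True by (simp add: T k_def)
          qed (auto simp: T)
          then show ?thesis by (simp add: indicator_def)
        qed simp
      qed
      then have "(\<integral>\<^sup>+ \<omega>. ennreal ?h * indicator (space M - U) \<omega> \<partial>M) \<le> (\<integral>\<^sup>+ \<omega>. T \<delta> \<omega> \<partial>M)"
        by (rule nn_integral_mono_AE)
      moreover have "(\<integral>\<^sup>+ \<omega>. ennreal ?h * indicator (space M - U) \<omega> \<partial>M) = ennreal (?h * (1 - prob U))"
        using U ln_pos c' by (simp add: nn_integral_cmult_indicator emeasure_eq_measure prob_compl ennreal_mult')
      moreover have "ennreal (?h * (1 - \<gamma>)) \<le> ennreal (?h * (1 - prob U))"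
        using \<open>prob U \<le> \<gamma>\<close> ln_pos c' by (intro ennreal_leI mult_left_mono) auto
      ultimately have "ennreal (?h * (1 - \<gamma>)) / ennreal (ln (1 / \<delta>)) \<le> ?f \<delta>"
        by (intro divide_right_mono_ennreal) (metis order_trans)
      moreover have "ennreal (?h * (1 - \<gamma>)) / ennreal (ln (1 / \<delta>)) = ennreal (?h * (1 - \<gamma>) / ln (1 / \<delta>))"
        using ln_pos c' \<gamma> by (intro divide_ennreal) auto
      ultimately show ?thesis using ln_pos by simp
    qed
    show ?thesis using small[OF a(1)]
    proof eventually_elim
      case (elim \<delta>)
      have "ennreal c < ennreal (c' * (1 - \<gamma>))" using \<gamma>(3) c by (simp add: ennreal_less_iff)
      then show ?case using bound[of \<delta>] elim by (meson order.strict_trans2)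
    qed
  qed
  show ?thesis
  proof (rule order_tendstoI)
    fix a assume a: "a < ennreal (1 / D)"
    then obtain c where c: "0 \<le> c" "a = ennreal c" by (cases a) auto
    then have "c < 1 / D" using a by (simp add: ennreal_less_iff)
    with lower c show "\<forall>\<^sub>F \<delta> in at_right 0. a < ?f \<delta>" by auto
  next
    fix a assume a: "ennreal (1 / D) < a"
    obtain c where c: "1 / D < c" "ennreal c \<le> a"
    proof (cases a)
      case (real x)
      then show ?thesis using a that[of x] D by (simp add: ennreal_less_iff)
    next
      case top
      then show ?thesis using that[of "1 / D + 1"] by simp
    qed
    show "\<forall>\<^sub>F \<delta> in at_right 0. ?f \<delta> < a"
      using upper[OF c(1)] by (rule eventually_mono) (erule order.strict_trans2[OF _ c(2)])
  qed
qed

section \<open>The sampling measure and concentration of the counts\<close>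

lemma pmf_answer_pmf:
  assumes "\<And>k. k \<in> {1..K} \<Longrightarrow> p k \<ge> 0" "(\<Sum>k=1..K. p k) = 1"
  shows "pmf (answer_pmf K p) k = (if k \<in> {1..K} then p k else 0)"
  unfolding answer_pmf_def
proof (rule pmf_embed_pmf)
  have "(\<integral>\<^sup>+ x. ennreal (if x \<in> {1..K} then p x else 0) \<partial>count_space UNIV)
      = (\<Sum>k=1..K. ennreal (p k))"
    by (subst nn_integral_count_space'[of "{1..K}"]) auto
  also have "\<dots> = ennreal (\<Sum>k=1..K. p k)" using assms(1) by (intro sum_ennreal)
  also have "\<dots> = 1" unfolding assms(2) by simp
  finally show "(\<integral>\<^sup>+ x. ennreal (if x \<in> {1..K} then p x else 0) \<partial>count_space UNIV) = 1" .
qed (use assms in auto)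

definition deviation :: "nat \<Rightarrow> (nat \<Rightarrow> real) \<Rightarrow> real \<Rightarrow> nat \<Rightarrow> (nat \<Rightarrow> nat) set" where
  "deviation K p \<eta> n = {\<omega>. \<exists>k\<in>{1..K}. \<bar>real (occ \<omega> n k) - real n * p k\<bar> \<ge> \<eta> * real n}"

lemma occ_eq_sum: "real (occ \<omega> n k) = (\<Sum>i<n. indicator {k} (\<omega> i))"
proof -
  have "{i. i < n \<and> \<omega> i = k} = {i \<in> {..<n}. \<omega> i = k}" by auto
  then show ?thesis unfolding occ_def by (simp add: indicator_def sum.If_cases Int_def)
qed

lemma space_sample_space [simp]: "space (sample_space K p) = UNIV"
  by (auto simp: sample_space_def space_PiM PiE_def extensional_def)

lemma occ_deviation_measurable:
  "{\<omega>. \<bar>real (occ \<omega> n k) - x\<bar> \<ge> y} \<in> sets (sample_space K p)"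
proof -
  have "(\<lambda>\<omega>. \<omega> i) \<in> measurable (sample_space K p) (count_space UNIV)" for i
    using measurable_component_singleton[of i UNIV "\<lambda>_. measure_pmf (answer_pmf K p)"]
    by (simp add: sample_space_def measurable_pmf_measure2)
  then have [measurable]: "(\<lambda>\<omega>. indicator {k} (\<omega> i) :: real) \<in> borel_measurable (sample_space K p)" for i
    by (rule measurable_compose) simp
  have "{\<omega> \<in> space (sample_space K p). \<bar>real (occ \<omega> n k) - x\<bar> \<ge> y} \<in> sets (sample_space K p)"
    unfolding occ_eq_sum by measurable
  then show ?thesis by simp
qed

lemma deviation_eq:
  "deviation K p \<eta> n = (\<Union>k\<in>{1..K}. {\<omega>. \<bar>real (occ \<omega> n k) - real n * p k\<bar> \<ge> \<eta> * real n})"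
  by (auto simp: deviation_def)

lemma deviation_measurable: "deviation K p \<eta> n \<in> sets (sample_space K p)"
  unfolding deviation_eq by (intro sets.finite_UN occ_deviation_measurable) auto

lemma prob_space_sample_space: "prob_space (sample_space K p)"
  unfolding sample_space_def by (intro prob_space_PiM measure_pmf.prob_space_axioms)

text \<open>Hoeffding's inequality for \<open>n\<close> independent indicators with mean
  \<open>p k\<close>: the squared ranges add up to \<open>n\<close>, so the exponent is
  \<open>- 2 * (\<eta> * n)^2 / n\<close>.\<close>

lemma occ_deviation_prob:
  assumes p: "\<And>k. k \<in> {1..K} \<Longrightarrow> p k \<ge> 0" "(\<Sum>k=1..K. p k) = 1"
    and k: "k \<in> {1..K}" and n: "n \<ge> 1" and \<eta>: "\<eta> > 0"
  shows "measure (sample_space K p) {\<omega>. \<bar>real (occ \<omega> n k) - real n * p k\<bar> \<ge> \<eta> * real n}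
      \<le> 2 * exp (- 2 * \<eta>\<^sup>2 * real n)"
proof -
  let ?q = "answer_pmf K p"
  interpret product_prob_space "\<lambda>_::nat. measure_pmf ?q" UNIV
    by unfold_locales
  interpret S: prob_space "sample_space K p" by (rule prob_space_sample_space)
  have comp: "distr (sample_space K p) (measure_pmf ?q) (\<lambda>\<omega>. \<omega> i) = measure_pmf ?q" for i
    unfolding sample_space_def by (intro distr_PiM_component measure_pmf.prob_space_axioms) simp
  have rv: "(\<lambda>\<omega>. \<omega> i) \<in> measurable (sample_space K p) (measure_pmf ?q)" for i
    unfolding sample_space_def by (intro measurable_component_singleton) simp
  \<comment> \<open>Independence is read off from the joint law of finitely many coordinates, which
    is the product of their laws; this criterion asks for a nonempty index set, supplied by
    \<open>n \<ge> 1\<close>.\<close>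
  have "S.indep_vars (\<lambda>_. measure_pmf ?q) (\<lambda>i \<omega>. \<omega> i) {..<n}"
  proof (subst S.indep_vars_iff_distr_eq_PiM')
    show "{..<n} \<noteq> {}" using n by (auto simp: lessThan_empty_iff)
    show "distr (sample_space K p) (Pi\<^sub>M {..<n} (\<lambda>i. measure_pmf ?q)) (\<lambda>x. \<lambda>i\<in>{..<n}. x i)
        = (\<Pi>\<^sub>M i\<in>{..<n}. distr (sample_space K p) (measure_pmf ?q) (\<lambda>\<omega>. \<omega> i))"
      unfolding comp unfolding sample_space_def by (rule distr_PiM_restrict_finite) auto
  qed (rule rv)
  then have indep: "S.indep_vars (\<lambda>_. borel) (\<lambda>i \<omega>. indicator {k} (\<omega> i) :: real) {..<n}"
    by (rule S.indep_vars_compose2) auto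
  have expect: "S.expectation (\<lambda>\<omega>. indicator {k} (\<omega> i) :: real) = p k" for i
  proof -
    have "S.expectation (\<lambda>\<omega>. indicator {k} (\<omega> i) :: real)
        = (\<integral>x. indicator {k} x  \<partial>distr (sample_space K p) (measure_pmf ?q) (\<lambda>\<omega>. \<omega> i))"
      by (subst integral_distr[OF rv]) auto
    also have "\<dots> = pmf ?q k" unfolding comp by (simp add: pmf.rep_eq)
    finally show ?thesis using pmf_answer_pmf[OF p] k by simp
  qed
  interpret H: Hoeffding_ineq "sample_space K p" "{..<n}" "\<lambda>i \<omega>. indicator {k} (\<omega> i)" "\<lambda>_. 0" "\<lambda>_. 1" "real n * p k"
  proof unfold_locales
    show "real n * p k \<equiv> \<Sum>i<n. S.expectation (\<lambda>\<omega>. indicator {k} (\<omega> i) :: real)"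
      by (simp add: expect)
    show "AE \<omega> in sample_space K p. indicator {k} (\<omega> i) \<in> {0..1::real}" for i
      by (simp add: indicator_def)
  qed (use indep in auto)
  have "S.prob {\<omega> \<in> space (sample_space K p). \<bar>(\<Sum>i<n. indicator {k} (\<omega> i)) - real n * p k\<bar> \<ge> \<eta> * real n}
      \<le> 2 * exp (- 2 * (\<eta> * real n)\<^sup>2 / (\<Sum>i<n. (1 - 0)\<^sup>2))"
    using n \<eta> by (intro H.Hoeffding_ineq_abs_ge) auto
  also have "- 2 * (\<eta> * real n)\<^sup>2 / (\<Sum>i<n. (1 - 0)\<^sup>2) = - 2 * \<eta>\<^sup>2 * real n"
    using n by (simp add: power2_eq_square)
  finally show ?thesis by (simp add: occ_eq_sum)
qed

text \<open>A union bound over the labels compares the series, from index 1 on, with a geometric one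
  of ratio \<open>exp (- 2 * \<eta>^2)\<close>.\<close>

lemma summable_deviation:
  assumes p: "\<And>k. k \<in> {1..K} \<Longrightarrow> p k \<ge> 0" "(\<Sum>k=1..K. p k) = 1" and \<eta>: "\<eta> > 0"
  shows "summable (\<lambda>n. measure (sample_space K p) (deviation K p \<eta> n))"
proof -
  interpret S: prob_space "sample_space K p" by (rule prob_space_sample_space)
  have bound: "S.prob (deviation K p \<eta> n) \<le> real K * 2 * exp (- 2 * \<eta>\<^sup>2) ^ n" if n: "n \<ge> 1" for n
  proof -
    let ?E = "\<lambda>k. {\<omega>. \<bar>real (occ \<omega> n k) - real n * p k\<bar> \<ge> \<eta> * real n}"
    have "S.prob (deviation K p \<eta> n) \<le> (\<Sum>k\<in>{1..K}. S.prob (?E k))"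
      unfolding deviation_eq using occ_deviation_measurable
      by (intro S.finite_measure_subadditive_finite) auto
    also have "\<dots> \<le> (\<Sum>k\<in>{1..K}. 2 * exp (- 2 * \<eta>\<^sup>2 * real n))"
      by (intro sum_mono occ_deviation_prob p n \<eta>)
    also have "\<dots> = real K * 2 * exp (- 2 * \<eta>\<^sup>2) ^ n"
      by (simp add: mult_ac flip: exp_of_nat_mult)
    finally show ?thesis .
  qed
  have "summable (\<lambda>n. real K * 2 * exp (- 2 * \<eta>\<^sup>2) ^ n)"
    using \<eta> by (intro summable_mult summable_geometric) auto
  then show ?thesis
    by (rule summable_comparison_test'[where N = 1]) (simp only: real_norm_def abs_of_nonneg[OF measure_nonneg] bound)
qed

lemma AE_labels:
  assumes p: "\<And>k. k \<in> {1..K} \<Longrightarrow> p k \<ge> 0" "(\<Sum>k=1..K. p k) = 1"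
  shows "AE \<omega> in sample_space K p. \<forall>i. \<omega> i \<in> {1..K}"
proof -
  have "pmf (answer_pmf K p) x = (if x \<in> {1..K} then p x else 0)" for x
    using p by (rule pmf_answer_pmf)
  then have "AE x in measure_pmf (answer_pmf K p). x \<in> {1..K}"
    unfolding AE_measure_pmf_iff set_pmf_eq by auto
  then have "AE \<omega> in sample_space K p. \<omega> i \<in> {1..K}" for i
    unfolding sample_space_def by (intro AE_PiM_component measure_pmf.prob_space_axioms) auto
  then show ?thesis by (simp add: AE_all_countable)
qed

section \<open>Posterior bounds for observed counts\<close>

lemma mset_top_counts: "mset (top_counts \<omega> n) = image_mset (occ \<omega> n) (mset_set (\<omega> ` {..<n}))"
proof -
  have "mset (sorted_list_of_set (\<omega> ` {..<n})) = mset_set (\<omega> ` {..<n})"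
    by (rule sorted_list_of_mset_set[THEN arg_cong[where f = mset], unfolded mset_sorted_list_of_multiset, symmetric])
  then show ?thesis by (simp add: top_counts_def)
qed

lemma set_top_counts: "set (top_counts \<omega> n) = occ \<omega> n ` \<omega> ` {..<n}"
  by (simp add: top_counts_def)

lemma length_top_counts: "length (top_counts \<omega> n) = card (\<omega> ` {..<n})"
  by (simp add: top_counts_def)

lemma sorted_top_counts: "sorted_wrt (\<ge>) (top_counts \<omega> n)"
  by (simp add: top_counts_def sorted_wrt_rev)

text \<open>The classes of equal answers partition the \<open>n\<close> sample indices.\<close>

lemma sum_list_top_counts: "sum_list (top_counts \<omega> n) = n"
proof -
  have "n = (\<Sum>i<n. 1)" by simp
  also have "\<dots> = (\<Sum>k\<in>\<omega> ` {..<n}. \<Sum>i\<in>{i \<in> {..<n}. \<omega> i = k}. 1)"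
    by (rule sum.image_gen) simp
  also have "\<dots> = (\<Sum>k\<in>\<omega> ` {..<n}. occ \<omega> n k)"
    by (auto intro!: sum.cong simp: occ_def intro: arg_cong[where f = card])
  also have "\<dots> = sum_mset (mset (top_counts \<omega> n))"
    by (simp only: mset_top_counts sum_unfold_sum_mset)
  finally show ?thesis by (simp add: sum_mset_sum_list)
qed

lemma top_counts_decr: "i \<le> j \<Longrightarrow> j < length (top_counts \<omega> n) \<Longrightarrow> top_counts \<omega> n ! j \<le> top_counts \<omega> n ! i"
  using sorted_wrt_nth_less[OF sorted_top_counts, of i j \<omega> n] by (cases "i = j") auto

lemma sum_nth_eq_sum_list_take:
  fixes cs :: "nat list"
  assumes "l \<le> length cs"
  shows "(\<Sum>i=1..l. cs ! (i - 1)) = sum_list (take l cs)"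
proof -
  have "(\<Sum>i=1..l. cs ! (i - 1)) = (\<Sum>i<l. cs ! i)"
    by (rule sum.reindex_bij_witness[where i = Suc and j = "\<lambda>i. i - 1"]) auto
  then show ?thesis using assms by (simp add: sum_list_sum_nth atLeast0LessThan min_def)
qed

text \<open>The default 0 treats an answer that has not appeared as a class of size 0, so the gap to
  the largest count stays meaningful when only one answer has been observed.\<close>

definition second_count :: "(nat \<Rightarrow> nat) \<Rightarrow> nat \<Rightarrow> nat" where
  "second_count \<omega> n = (if length (top_counts \<omega> n) \<ge> 2 then top_counts \<omega> n ! 1 else 0)"

text \<open>The complement \<open>B / (A + B)\<close> is at most \<open>B / A\<close>, hence at most
  \<open>y\<close>.\<close>

lemma fraction_ge:
  fixes A B y :: real
  assumes "A > 0" "B \<ge> 0" "B \<le> y * A"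
  shows "1 - y \<le> A / (A + B)"
proof -
  have "(1 - y) * (A + B) = A + (B - y * A) - y * B" by (simp add: algebra_simps)
  also have "\<dots> \<le> A"
  proof -
    have "0 \<le> y * A" using assms by linarith
    then have "y \<ge> 0" using assms(1) by (simp add: zero_le_mult_iff)
    then show ?thesis using assms mult_nonneg_nonneg[of y B] by linarith
  qed
  finally show ?thesis using assms by (simp add: pos_le_divide_eq)
qed

text \<open>This is \<open>1 / (1 + y) \<le> 1 - y / 2\<close> on the unit interval. For
  \<open>A = 0\<close> the fraction is 0.\<close>

lemma fraction_le:
  fixes A B y :: real
  assumes "A \<ge> 0" "B \<ge> 0" "B \<ge> y * A" "0 \<le> y" "y \<le> 1"
  shows "A / (A + B) \<le> 1 - y / 2"
proof (cases "A = 0")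
  case False
  then have A: "A > 0" using assms by simp
  have "A \<le> (1 - y / 2) * (1 + y) * A"
  proof -
    have "y * (1 - y) \<ge> 0" using assms by (intro mult_nonneg_nonneg) auto
    then have "1 \<le> (1 - y / 2) * (1 + y)" by (simp add: algebra_simps)
    then show ?thesis using A by (simp add: mult_left_le_imp_le)
  qed
  also have "\<dots> = (1 - y / 2) * (A + y * A)" by (simp add: algebra_simps)
  also have "\<dots> \<le> (1 - y / 2) * (A + B)" using assms by (intro mult_left_mono) auto
  finally show ?thesis using A assms by (simp add: pos_divide_le_eq)
qed (use assms in auto)

section \<open>The answer distribution and deterministic posterior bounds along a sample\<close>

locale answer_model =
  fixes K :: nat and p :: "nat \<Rightarrow> real"
  assumes K2: "K \<ge> 2"
    and p12: "p 1 > p 2"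
    and p_decr: "\<And>i j. 2 \<le> i \<Longrightarrow> i \<le> j \<Longrightarrow> j \<le> K \<Longrightarrow> p j \<le> p i"
    and pK: "p K > 0"
    and sum_p: "(\<Sum>k=1..K. p k) = 1"
begin

lemma p_pos: "k \<in> {1..K} \<Longrightarrow> p k > 0"
proof -
  assume k: "k \<in> {1..K}"
  have 2: "p j > 0" if "j \<in> {2..K}" for j
    using that p_decr[of j K] pK by auto
  have "p 1 > 0" using p12 2[of 2] K2 by simp
  then show "p k > 0" using 2[of k] k by (cases "k = 1") auto
qed

lemma p_nonneg: "k \<in> {1..K} \<Longrightarrow> p k \<ge> 0"
  using p_pos less_imp_le by blast

lemma p1_pos: "p 1 > 0" and p2_pos: "p 2 > 0"
  using p_pos K2 by auto

lemma sum_without: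
  assumes "i \<in> {1..K}"
  shows "(\<Sum>j\<in>{1..K} - {i}. p j) = 1 - p i"
  using sum_p assms by (simp add: sum_diff1)

lemma p_le_p2: "k \<in> {2..K} \<Longrightarrow> p k \<le> p 2"
  using p_decr[of 2 k] by auto

lemma p1_lt_1: "p 1 < 1"
proof -
  have "0 < (\<Sum>j\<in>{1..K} - {1}. p j)"
    using K2 p_pos by (intro sum_pos) (auto simp: set_eq_iff intro!: exI[of _ 2])
  then show ?thesis using sum_without[of 1] K2 by auto
qed

end

locale answer_sample = answer_model +
  fixes \<omega> :: "nat \<Rightarrow> nat" and n :: nat
  assumes labels: "\<And>i. \<omega> i \<in> {1..K}" and n1: "n \<ge> 1"
begin

abbreviation "cs \<equiv> top_counts \<omega> n"

lemma length_cs: "1 \<le> length cs" "length cs \<le> K"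
proof -
  have "\<omega> 0 \<in> \<omega> ` {..<n}" using n1 by auto
  then have "card (\<omega> ` {..<n}) > 0" unfolding card_gt_0_iff by blast
  then show "1 \<le> length cs" unfolding length_top_counts by linarith
  have "card (\<omega> ` {..<n}) \<le> card {1..K}" using labels by (intro card_mono) auto
  then show "length cs \<le> K" by (simp add: length_top_counts)
qed

lemma cs_0_le: "cs ! 0 \<le> n"
proof -
  have "cs ! 0 \<in> set cs" using length_cs(1) by (intro nth_mem) linarith
  then show ?thesis using member_le_sum_list[of "cs ! 0" cs] by (simp add: sum_list_top_counts)
qed

lemma agg_state_cs:
  assumes "L \<ge> 2"
  shows "agg_state K (min (L - 1) (length cs)) (cs ! (min (L - 1) (length cs) - 1)) p (\<lambda>j. cs ! (j - 1))"
  using assms K2 p12 p_decr p_pos length_cs by unfold_locales (auto intro!: top_counts_decr)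

text \<open>At most \<open>K - l\<close> further answers occur, each at most as often as the
  \<open>l\<close>-th. This is the room condition of \<open>mass_1_pos\<close>.\<close>

lemma rest_count_le:
  assumes "1 \<le> l" "l \<le> length cs"
  shows "n - (\<Sum>i=1..l. cs ! (i - 1)) \<le> (K - l) * cs ! (l - 1)"
proof -
  have "sum_list (take l cs) + sum_list (drop l cs) = n"
    by (metis append_take_drop_id sum_list_append sum_list_top_counts)
  then have "n - (\<Sum>i=1..l. cs ! (i - 1)) = sum_list (drop l cs)"
    unfolding sum_nth_eq_sum_list_take[OF assms(2)] by simp
  also have "\<dots> = (\<Sum>i<length cs - l. cs ! (l + i))"
    by (simp add: sum_list_sum_nth atLeast0LessThan)
  also have "\<dots> \<le> (\<Sum>i<length cs - l. cs ! (l - 1))"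
    using assms by (intro sum_mono top_counts_decr) auto
  also have "\<dots> \<le> (K - l) * cs ! (l - 1)"
    using length_cs by auto
  finally show ?thesis .
qed

text \<open>At a fixed \<open>n\<close> the posterior stays away from 1 uniformly over all samples,
  because the largest count is at most \<open>n\<close>. It provides the \<open>early\<close>
  hypothesis of \<open>first_passage_limit\<close>.\<close>

lemma posterior_le_early:
  assumes "L \<ge> 2"
  shows "agg_posterior K p L n cs \<le> 1 - (p 2 / p 1) ^ n / 2"
proof -
  define l where "l = min (L - 1) (length cs)"
  define v where "v = cs ! (l - 1)"
  define c where "c = card {j \<in> {1..l}. cs ! (j - 1) = v}"
  define N where "N = n - (\<Sum>i=1..l. cs ! (i - 1))"
  interpret S: agg_state K l v c N p "\<lambda>j. cs ! (j - 1)"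
    using agg_state_cs[OF assms] by (simp only: l_def v_def)
  have eq: "agg_posterior K p L n cs = S.mass 1 / (S.mass 1 + (\<Sum>k\<in>{2..K}. S.mass k))"
    using agg_posterior_eq[OF agg_state_cs[OF assms]] unfolding l_def v_def c_def N_def .
  have ratio: "0 \<le> p 2 / p 1" "p 2 / p 1 \<le> 1" using p1_pos p2_pos p12 by auto
  have "(p 2 / p 1) ^ n * S.mass 1 \<le> (p 2 / p 1) ^ (cs ! (1 - 1)) * S.mass 1"
    using ratio cs_0_le by (intro mult_right_mono power_decreasing S.mass_nonneg) auto
  also have "\<dots> \<le> (\<Sum>k\<in>{2..K}. S.mass k)"
    using S.mass_2_ge S.rest_ge by (rule order_trans)
  finally show ?thesis
    unfolding eq using ratio by (intro fraction_le S.mass_nonneg sum_nonneg) (auto intro: power_le_one)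
qed

text \<open>For \<open>L \<ge> 3\<close> the state retains the second largest count whenever there
  is one, so both mass comparisons involve the same gap \<open>g\<close>.\<close>

lemma posterior_bounds_ge_3:
  assumes L: "L \<ge> 3"
  defines "g \<equiv> cs ! 0 - second_count \<omega> n"
  shows "1 - real K * (p 2 / p 1) ^ g \<le> agg_posterior K p L n cs"
    and "agg_posterior K p L n cs \<le> 1 - (p 2 / p 1) ^ g / (2 * real K)"
proof -
  have L2: "L \<ge> 2" using L by simp
  define l where "l = min (L - 1) (length cs)"
  define v where "v = cs ! (l - 1)"
  define c where "c = card {j \<in> {1..l}. cs ! (j - 1) = v}"
  define N where "N = n - (\<Sum>i=1..l. cs ! (i - 1))"
  interpret S: agg_state K l v c N p "\<lambda>j. cs ! (j - 1)"
    using agg_state_cs[OF L2] by (simp only: l_def v_def)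
  have eq: "agg_posterior K p L n cs = S.mass 1 / (S.mass 1 + (\<Sum>k\<in>{2..K}. S.mass k))"
    using agg_posterior_eq[OF agg_state_cs[OF L2]] unfolding l_def v_def c_def N_def .
  have l: "1 \<le> l" "l \<le> length cs" using L length_cs by (auto simp: l_def)
  have l2: "l \<ge> 2 \<longleftrightarrow> length cs \<ge> 2" using L by (auto simp: l_def)
  have ratio: "0 \<le> p 2 / p 1" "p 2 / p 1 \<le> 1" using p1_pos p2_pos p12 by auto
  have pos: "S.mass 1 > 0"
    using S.mass_1_pos rest_count_le[OF l] by (simp add: N_def v_def)
  \<comment> \<open>With a single top count the sample contains only one answer, so every other
    label receives 0 samples, in line with the default of \<open>second_count\<close>.\<close>
  have N0: "N = 0" if "\<not> l \<ge> 2"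
  proof -
    have "length cs = l" using that l l2 by auto
    then show ?thesis
      using sum_nth_eq_sum_list_take[OF l(2)] by (simp add: N_def sum_list_top_counts)
  qed
  have second: "second_count \<omega> n \<le> cs ! 0"
    by (auto simp: second_count_def intro!: top_counts_decr)
  have "S.mass k \<le> (p 2 / p 1) ^ (cs ! (1 - 1) - second_count \<omega> n) * S.mass 1" if k: "k \<in> {2..K}" for k
  proof (rule S.mass_le_mass_1[OF k])
    fix \<psi> r assume \<psi>: "\<psi> \<in> S.inj_maps" "\<psi> 1 = 1" and r: "r \<in> alloc (S.free \<psi>) v N"
    show "S.cnt \<psi> r k \<le> second_count \<omega> n"
    proof (cases "l \<ge> 2")
      case True
      \<comment> \<open>Label 1 is on top, so \<open>k \<ge> 2\<close> takes second place at
        best.\<close>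
      have "S.cnt \<psi> r k \<le> cs ! (2 - 1)"
      proof (rule S.cnt_le[OF \<psi>(1) r])
        fix j :: nat assume "1 \<le> j" "j < 2"
        then have "j = 1" by simp
        then show "\<psi> j \<noteq> k" using \<psi>(2) k by simp
      qed (use True k in auto)
      then show ?thesis using True l2 by (simp add: second_count_def)
    next
      case False
      then have "l = 1" using l by simp
      then have "k \<notin> \<psi> ` {1..l}" using \<psi>(2) k by auto
      then have "k \<in> S.free \<psi>" "S.cnt \<psi> r k = r k"
        using k unfolding S.free_def S.cnt_def by simp_all
      moreover have "r \<in> alloc (S.free \<psi>) N N" using alloc_le_sum[of "S.free \<psi>"] r by auto
      ultimately show ?thesis using N0[OF False] unfolding alloc_def by fastforce
    qed
  qed (use second in simp)
  then have "(\<Sum>k\<in>{2..K}. S.mass k) \<le> (\<Sum>k\<in>{2..K}. (p 2 / p 1) ^ g * S.mass 1)"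
    by (intro sum_mono) (simp add: g_def)
  also have "\<dots> \<le> real K * ((p 2 / p 1) ^ g * S.mass 1)"
    using ratio S.mass_nonneg[of 1] by (auto intro!: mult_right_mono mult_nonneg_nonneg)
  finally show "1 - real K * (p 2 / p 1) ^ g \<le> agg_posterior K p L n cs"
    unfolding eq using pos by (intro fraction_ge sum_nonneg S.mass_nonneg) (auto simp: mult_ac)
  \<comment> \<open>If only one answer has been observed, the gap is the whole largest count and the
    crude bound \<open>mass_2_ge\<close> is already sharp enough.\<close>
  have "(p 2 / p 1) ^ g * S.mass 1 \<le> real K * S.mass 2"
  proof (cases "l \<ge> 2")
    case True
    then show ?thesis using S.mass_2_ge_gap l2 by (simp add: g_def second_count_def)
  next
    case False
    then have "(p 2 / p 1) ^ g * S.mass 1 \<le> 1 * S.mass 2"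
      using S.mass_2_ge l2 by (simp add: g_def second_count_def)
    also have "\<dots> \<le> real K * S.mass 2" using K2 by (intro mult_right_mono S.mass_nonneg) auto
    finally show ?thesis .
  qed
  also have "\<dots> \<le> real K * (\<Sum>k\<in>{2..K}. S.mass k)" by (intro mult_left_mono S.rest_ge) simp
  finally have "(p 2 / p 1) ^ g * S.mass 1 / real K \<le> (\<Sum>k\<in>{2..K}. S.mass k)"
    using K2 by (subst pos_divide_le_eq) (auto simp only: mult.commute of_nat_0_less_iff)
  then have "(p 2 / p 1) ^ g / real K * S.mass 1 \<le> (\<Sum>k\<in>{2..K}. S.mass k)" by simp
  moreover have "(p 2 / p 1) ^ g / real K \<le> 1"
    using power_le_one[OF ratio, of g] K2 by (simp add: divide_le_eq)
  ultimately have "agg_posterior K p L n cs \<le> 1 - (p 2 / p 1) ^ g / real K / 2"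
    unfolding eq using ratio by (intro fraction_le S.mass_nonneg sum_nonneg) auto
  then show "agg_posterior K p L n cs \<le> 1 - (p 2 / p 1) ^ g / (2 * real K)" by (simp add: mult.commute)
qed

text \<open>Dropping the cap \<open>r\<^sub>j \<le> n\<^sub>1\<close> and the tie weights turns \<open>A\<^sub>i\<close> into this product.\<close>
definition lik :: "nat \<Rightarrow> real" where
  "lik i = p i ^ (cs ! 0) * (1 - p i) ^ (n - cs ! 0)"

text \<open>For labels 1 and 2 the mass lies between \<open>lik i / C\<close> and
  \<open>lik i\<close>, and all wrong labels together weigh between \<open>mass 2\<close> and
  \<open>K * mass 2\<close>. The \<open>min 1\<close> meets the range condition of
  \<open>fraction_le\<close>.\<close>

lemma posterior_bounds_2:
  assumes fs: "\<And>i. i \<in> {1, 2} \<Longrightarrow>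
      (1 - p i) ^ (n - cs ! 0) \<le> C * free_sum p 1 (cs ! 0) (n - cs ! 0) ({1..K} - {i})"
    and C: "C \<ge> 1"
  shows "1 - real K * C * (lik 2 / lik 1) \<le> agg_posterior K p 2 n cs"
    and "agg_posterior K p 2 n cs \<le> 1 - min 1 (lik 2 / (C * lik 1)) / 2"
proof -
  define l where "l = min (2 - 1) (length cs)"
  define v where "v = cs ! (l - 1)"
  define c where "c = card {j \<in> {1..l}. cs ! (j - 1) = v}"
  define N where "N = n - (\<Sum>i=1..l. cs ! (i - 1))"
  have l1: "l = 1" using length_cs by (simp add: l_def)
  have vcN: "v = cs ! 0" "c = 1" "N = n - cs ! 0"
  proof -
    show v: "v = cs ! 0" by (simp add: v_def l1)
    have "{j \<in> {1..l}. cs ! (j - 1) = v} = {1}" using v l1 by auto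
    then show "c = 1" by (simp add: c_def)
    show "N = n - cs ! 0" by (simp add: N_def l1)
  qed
  interpret S: agg_state K l v c N p "\<lambda>j. cs ! (j - 1)"
    using agg_state_cs[of 2] unfolding l_def v_def by simp
  have eq: "agg_posterior K p 2 n cs = S.mass 1 / (S.mass 1 + (\<Sum>k\<in>{2..K}. S.mass k))"
    using agg_posterior_eq[OF agg_state_cs[of 2]] unfolding l_def v_def c_def N_def by simp
  have p1: "1 - p 1 > 0" "1 - p 2 > 0" using p1_lt_1 p12 by auto
  have lik: "lik 1 > 0" "lik 2 > 0"
    unfolding lik_def using p1 p1_pos p2_pos by auto
  have i: "i \<in> {1..K}" if "i \<in> {1, 2}" for i using that K2 by auto
  have mass: "S.mass i = p i ^ (cs ! 0) * free_sum p 1 (cs ! 0) (n - cs ! 0) ({1..K} - {i})" if "i \<in> {1, 2}" for i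
    using S.mass_single[OF l1 i[OF that]] vcN by simp
  have le: "S.mass i \<le> lik i" if "i \<in> {1, 2}" for i
  proof -
    have "free_sum p 1 (cs ! 0) (n - cs ! 0) ({1..K} - {i}) \<le> (\<Sum>j\<in>{1..K} - {i}. p j) ^ (n - cs ! 0)"
      by (intro free_sum_le) (auto intro: p_pos[unfolded One_nat_def])
    then show ?thesis unfolding mass[OF that] lik_def sum_without[OF i[OF that]]
      using p_nonneg[OF i[OF that]] by (intro mult_left_mono) auto
  qed
  have ge: "lik i \<le> C * S.mass i" if "i \<in> {1, 2}" for i
    unfolding mass[OF that] lik_def using fs[OF that] p_nonneg[OF i[OF that]]
    by (subst mult.left_commute) (intro mult_left_mono, auto)
  have "S.mass 1 > 0"
    using S.mass_1_pos rest_count_le[of l] l1 length_cs(1) by (simp add: N_def v_def)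
  have "(\<Sum>k\<in>{2..K}. S.mass k) \<le> (\<Sum>k\<in>{2..K}. S.mass 2)"
    by (intro sum_mono S.mass_le_mass_2)
  also have "\<dots> \<le> real K * S.mass 2" using S.mass_nonneg[of 2] by (auto intro!: mult_right_mono)
  also have "\<dots> \<le> real K * lik 2" by (intro mult_left_mono le) auto
  also have "\<dots> = real K * (lik 2 / lik 1) * lik 1" using lik by simp
  also have "\<dots> \<le> real K * (lik 2 / lik 1) * (C * S.mass 1)"
    using lik by (intro mult_left_mono ge) auto
  finally show "1 - real K * C * (lik 2 / lik 1) \<le> agg_posterior K p 2 n cs"
    unfolding eq using \<open>S.mass 1 > 0\<close> by (intro fraction_ge sum_nonneg S.mass_nonneg) (auto simp: mult_ac)
  have "min 1 (lik 2 / (C * lik 1)) * S.mass 1 \<le> lik 2 / (C * lik 1) * S.mass 1"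
    by (intro mult_right_mono S.mass_nonneg) auto
  also have "\<dots> \<le> lik 2 / (C * lik 1) * lik 1"
    using lik C by (intro mult_left_mono le) auto
  also have "\<dots> = lik 2 / C" using lik by simp
  also have "\<dots> \<le> S.mass 2" using ge[of 2] C by (simp add: pos_divide_le_eq mult.commute)
  also have "\<dots> \<le> (\<Sum>k\<in>{2..K}. S.mass k)" by (rule S.rest_ge)
  finally show "agg_posterior K p 2 n cs \<le> 1 - min 1 (lik 2 / (C * lik 1)) / 2"
    unfolding eq using lik C by (intro fraction_le S.mass_nonneg sum_nonneg) auto
qed

text \<open>A deviation of at most half the gap \<open>p 1 - p 2\<close> forces label 1 to be the
  strict leader, so the largest count is its count. The second largest is then the maximum over the
  other labels.\<close>

lemma typical_counts:
  assumes tp: "\<omega> \<notin> deviation K p \<eta> n" and \<eta>: "2 * \<eta> \<le> p 1 - p 2"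
  shows "\<bar>real (cs ! 0) - real n * p 1\<bar> < \<eta> * real n"
    and "\<bar>real (second_count \<omega> n) - real n * p 2\<bar> < \<eta> * real n"
proof -
  have dev: "\<bar>real (occ \<omega> n k) - real n * p k\<bar> < \<eta> * real n" if "k \<in> {1..K}" for k
    using tp that by (auto simp: deviation_def not_le)
  have "0 < \<eta> * real n" using dev[of 1] K2 by (auto intro: order.strict_trans1[OF abs_ge_zero])
  then have \<eta>0: "\<eta> > 0" using n1 by (simp add: zero_less_mult_iff)
  have occ_lt: "real (occ \<omega> n k) < real n * (p 2 + \<eta>)" if k: "k \<in> {2..K}" for k
  proof -
    have "real n * p k \<le> real n * p 2" using p_le_p2[OF k] by (intro mult_left_mono) auto
    then show ?thesis using dev[of k] k by (auto simp: algebra_simps)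
  qed
  have "real n * (p 2 + \<eta>) \<le> real n * (p 1 - \<eta>)" using \<eta> by (intro mult_left_mono) auto
  also have "\<dots> < real (occ \<omega> n 1)" using dev[of 1] K2 by (auto simp: algebra_simps)
  finally have occ1: "real n * (p 2 + \<eta>) < real (occ \<omega> n 1)" .
  have occ_max: "occ \<omega> n k < occ \<omega> n 1" if "k \<in> {2..K}" for k
    using occ_lt[OF that] occ1 by linarith
  let ?S = "\<omega> ` {..<n}"
  have S: "?S \<subseteq> {1..K}" using labels by auto
  have in_S: "k \<in> ?S" if "occ \<omega> n k > 0" for k
    using that by (auto simp: occ_def card_gt_0_iff)
  have S1: "1 \<in> ?S" using occ_max[of 2] K2 by (intro in_S) auto
  obtain x xs where cs: "cs = x # xs" using length_cs by (cases cs) auto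
  have x: "x = occ \<omega> n 1"
  proof -
    have "x \<in> occ \<omega> n ` ?S" using set_top_counts[of \<omega> n] cs by auto
    then obtain k where k: "k \<in> ?S" "x = occ \<omega> n k" by auto
    have "occ \<omega> n 1 \<in> set cs" using S1 set_top_counts[of \<omega> n] by auto
    then have "occ \<omega> n 1 \<le> x" using sorted_top_counts[of \<omega> n] cs by auto
    then have "k = 1" using occ_max[of k] k S by (cases "k = 1") auto
    then show ?thesis using k by simp
  qed
  then show "\<bar>real (cs ! 0) - real n * p 1\<bar> < \<eta> * real n" using dev[of 1] K2 cs by auto
  have "mset xs = image_mset (occ \<omega> n) (mset_set (?S - {1}))"
  proof -
    have "mset_set ?S = add_mset 1 (mset_set (?S - {1}))"
      using S1 by (intro mset_set.remove) auto
    then show ?thesis using mset_top_counts[of \<omega> n] by (simp add: cs x)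
  qed
  then have "set_mset (mset xs) = set_mset (image_mset (occ \<omega> n) (mset_set (?S - {1})))" by simp
  then have set_xs: "set xs = occ \<omega> n ` (?S - {1})" by simp
  \<comment> \<open>Label 2 need not be the runner-up, as other labels may be equally probable: its
    count only bounds the second largest from below, and \<open>occ_lt\<close> gives the upper bound
    for all competitors.\<close>
  have "occ \<omega> n 2 \<le> second_count \<omega> n"
  proof (cases "occ \<omega> n 2 > 0")
    case True
    then have "occ \<omega> n 2 \<in> set xs" unfolding set_xs using in_S by auto
    then obtain y ys where "xs = y # ys" "occ \<omega> n 2 \<le> y"
      using sorted_top_counts[of \<omega> n] cs by (cases xs) auto
    then show ?thesis by (simp add: second_count_def cs)
  qed simp
  moreover have "real (second_count \<omega> n) < real n * (p 2 + \<eta>)"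
  proof (cases xs)
    case Nil
    then show ?thesis using n1 p2_pos \<eta>0 by (simp add: second_count_def cs)
  next
    case (Cons y ys)
    then have "y \<in> occ \<omega> n ` (?S - {1})" using set_xs by (metis list.set_intros(1))
    then obtain k where "k \<in> ?S - {1}" "y = occ \<omega> n k" by blast
    then have "real y < real n * (p 2 + \<eta>)" using occ_lt[of k] S by force
    then show ?thesis using Cons by (simp add: second_count_def cs)
  qed
  moreover have "real n * p 2 - \<eta> * real n < real (occ \<omega> n 2)" using dev[of 2] K2 by auto
  ultimately show "\<bar>real (second_count \<omega> n) - real n * p 2\<bar> < \<eta> * real n"
    by (simp add: abs_less_iff algebra_simps)
qed

end

section \<open>Exponential rates\<close>

lemma exp_linear_eventually_ge:
  fixes a C :: real
  assumes "a > 0"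
  obtains n0 where "\<And>n. n \<ge> n0 \<Longrightarrow> C \<le> exp (a * real n)"
proof
  fix n assume "n \<ge> nat \<lceil>C / a\<rceil>"
  then have "C / a \<le> real n" by linarith
  then have "C \<le> a * real n" using assms by (simp add: field_simps)
  then show "C \<le> exp (a * real n)" using exp_ge_add_one_self[of "a * real n"] by linarith
qed

text \<open>One half of \<open>\<epsilon>\<close> is the error of the exponent of \<open>y\<close>;
  the other half pays for the constant factor \<open>2 * C\<close> once \<open>n\<close> is
  large.\<close>

lemma rate_bounds:
  fixes X y C D \<epsilon> :: real
  assumes X: "1 - C * y \<le> X" "X \<le> 1 - min 1 (y / C) / 2"
    and y: "exp (- real n * (D + \<epsilon> / 2)) \<le> y" "y \<le> exp (- real n * (D - \<epsilon> / 2))"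
    and C: "C \<ge> 1" "2 * C \<le> exp (\<epsilon> / 2 * real n)" and D: "D \<ge> 0" and \<epsilon>: "\<epsilon> > 0"
  shows "1 - exp (- real n * (D - \<epsilon>)) \<le> X" "X \<le> 1 - exp (- real n * (D + \<epsilon>))"
proof -
  have "C * y \<le> exp (\<epsilon> / 2 * real n) * exp (- real n * (D - \<epsilon> / 2))"
    using C y order_trans[OF less_imp_le[OF exp_gt_zero] y(1)] by (intro mult_mono) auto
  also have "\<dots> = exp (- real n * (D - \<epsilon>))"
    unfolding exp_add[symmetric] by (simp add: algebra_simps)
  finally show "1 - exp (- real n * (D - \<epsilon>)) \<le> X" using X by linarith
  have "exp (- real n * (D + \<epsilon>)) * (2 * C) \<le> exp (- real n * (D + \<epsilon>)) * exp (\<epsilon> / 2 * real n)"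
    using C by (intro mult_left_mono) auto
  also have "\<dots> = exp (- real n * (D + \<epsilon> / 2))"
    unfolding exp_add[symmetric] by (simp add: algebra_simps)
  finally have e: "exp (- real n * (D + \<epsilon>)) * (2 * C) \<le> exp (- real n * (D + \<epsilon> / 2))" .
  have "exp (- real n * (D + \<epsilon>)) \<le> y / C / 2"
    using order_trans[OF e y(1)] C by (simp add: field_simps)
  \<comment> \<open>This covers the case in which the minimum is attained by 1.\<close>
  moreover have "exp (- real n * (D + \<epsilon>)) \<le> 1 / 2"
  proof -
    have "exp (- real n * (D + \<epsilon>)) * 2 \<le> exp (- real n * (D + \<epsilon>)) * (2 * C)"
      using C by (intro mult_left_mono) auto
    also have "\<dots> \<le> exp (- real n * (D + \<epsilon> / 2))" by (rule e)
    also have "\<dots> \<le> 1" using D \<epsilon> by (simp add: mult_nonneg_nonneg)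
    finally show ?thesis by simp
  qed
  ultimately have "exp (- real n * (D + \<epsilon>)) \<le> min 1 (y / C) / 2" by (simp add: min_def)
  then show "X \<le> 1 - exp (- real n * (D + \<epsilon>))" using X by linarith
qed

context answer_model
begin

text \<open>Instance of \<open>first_passage_limit\<close> with the deviation events as bad events.
  What remains is a deterministic estimate of the posterior outside them.\<close>

lemma stop_time_limit:
  assumes L: "L \<ge> 2" and D: "D > 0"
    and typical: "\<And>\<epsilon>. \<epsilon> > 0 \<Longrightarrow> \<exists>\<eta>>0. \<exists>n0. \<forall>\<omega> n. answer_sample K p \<omega> n \<longrightarrow> n \<ge> n0 \<longrightarrow> \<omega> \<notin> deviation K p \<eta> n \<longrightarrow>
        1 - exp (- real n * (D - \<epsilon>)) \<le> agg_posterior K p L n (top_counts \<omega> n) \<and>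
        agg_posterior K p L n (top_counts \<omega> n) \<le> 1 - exp (- real n * (D + \<epsilon>))"
  shows "((\<lambda>\<delta>. expected_stop K p L \<delta> / ennreal (ln (1 / \<delta>))) \<longlongrightarrow> ennreal (1 / D)) (at_right 0)"
  unfolding expected_stop_def
proof (rule prob_space.first_passage_limit[OF prob_space_sample_space D])
  have sample: "answer_sample K p \<omega> n" if "\<forall>i. \<omega> i \<in> {1..K}" "n \<ge> 1" for \<omega> n
    using that by unfold_locales auto
  have AE: "AE \<omega> in sample_space K p. \<forall>i. \<omega> i \<in> {1..K}"
    using p_nonneg sum_p by (rule AE_labels)
  show "\<exists>B n0. (\<forall>n. B n \<in> sets (sample_space K p)) \<and>
      summable (\<lambda>n. measure (sample_space K p) (B n)) \<and>
      (AE \<omega> in sample_space K p. \<forall>n\<ge>n0. \<omega> \<notin> B n \<longrightarrow>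
         1 - exp (- real n * (D - \<epsilon>)) \<le> agg_posterior K p L n (top_counts \<omega> n) \<and>
         agg_posterior K p L n (top_counts \<omega> n) \<le> 1 - exp (- real n * (D + \<epsilon>)))" if "\<epsilon> > 0" for \<epsilon>
  proof -
    obtain \<eta> n0 where "\<eta> > 0" and b: "\<And>\<omega> n. answer_sample K p \<omega> n \<Longrightarrow> n \<ge> n0 \<Longrightarrow> \<omega> \<notin> deviation K p \<eta> n \<Longrightarrow>
        1 - exp (- real n * (D - \<epsilon>)) \<le> agg_posterior K p L n (top_counts \<omega> n) \<and>
        agg_posterior K p L n (top_counts \<omega> n) \<le> 1 - exp (- real n * (D + \<epsilon>))"
      using typical[OF \<open>\<epsilon> > 0\<close>] by metis
    have "summable (\<lambda>n. measure (sample_space K p) (deviation K p \<eta> n))"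
      using p_nonneg sum_p \<open>\<eta> > 0\<close> by (rule summable_deviation)
    \<comment> \<open>The maximum with 1 excludes the empty sample, which
      \<open>answer_sample\<close> does not admit.\<close>
    moreover have "AE \<omega> in sample_space K p. \<forall>n\<ge>max n0 1. \<omega> \<notin> deviation K p \<eta> n \<longrightarrow>
         1 - exp (- real n * (D - \<epsilon>)) \<le> agg_posterior K p L n (top_counts \<omega> n) \<and>
         agg_posterior K p L n (top_counts \<omega> n) \<le> 1 - exp (- real n * (D + \<epsilon>))"
      using AE
    proof (rule eventually_mono, intro allI impI)
      fix \<omega> n assume "\<forall>i. \<omega> i \<in> {1..K}" "max n0 1 \<le> n" "\<omega> \<notin> deviation K p \<eta> n"
      then show "1 - exp (- real n * (D - \<epsilon>)) \<le> agg_posterior K p L n (top_counts \<omega> n) \<and>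
         agg_posterior K p L n (top_counts \<omega> n) \<le> 1 - exp (- real n * (D + \<epsilon>))"
        by (intro b sample) auto
    qed
    ultimately show ?thesis using deviation_measurable by blast
  qed
  show "\<exists>a>0. AE \<omega> in sample_space K p. agg_posterior K p L n (top_counts \<omega> n) \<le> 1 - a" if "n \<ge> 1" for n
  proof (intro exI conjI)
    show "(p 2 / p 1) ^ n / 2 > 0" using p1_pos p2_pos by simp
    show "AE \<omega> in sample_space K p. agg_posterior K p L n (top_counts \<omega> n) \<le> 1 - (p 2 / p 1) ^ n / 2"
      using AE
    proof (rule eventually_mono)
      fix \<omega> :: "nat \<Rightarrow> nat" assume "\<forall>i. \<omega> i \<in> {1..K}"
      then interpret answer_sample K p \<omega> n using \<open>n \<ge> 1\<close> by (rule sample)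
      show "agg_posterior K p L n cs \<le> 1 - (p 2 / p 1) ^ n / 2" by (rule posterior_le_early[OF L])
    qed
  qed
qed (simp only: stop_time_def)

text \<open>The normalised gap \<open>g / n\<close> is within \<open>2 * \<eta>\<close> of
  \<open>p 1 - p 2\<close>, and each unit of the gap contributes \<open>ln (p 1 / p 2)\<close> to
  the exponent.\<close>

lemma typical_ge_3:
  assumes L: "L \<ge> 3" and \<epsilon>: "\<epsilon> > 0"
  defines "D \<equiv> (p 1 - p 2) * ln (p 1 / p 2)"
  shows "\<exists>\<eta>>0. \<exists>n0. \<forall>\<omega> n. answer_sample K p \<omega> n \<longrightarrow> n \<ge> n0 \<longrightarrow> \<omega> \<notin> deviation K p \<eta> n \<longrightarrow>
        1 - exp (- real n * (D - \<epsilon>)) \<le> agg_posterior K p L n (top_counts \<omega> n) \<and>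
        agg_posterior K p L n (top_counts \<omega> n) \<le> 1 - exp (- real n * (D + \<epsilon>))"
proof -
  define \<Lambda> where "\<Lambda> = ln (p 1 / p 2)"
  have \<Lambda>: "\<Lambda> > 0" using p12 p2_pos by (simp add: \<Lambda>_def)
  have D0: "D \<ge> 0" using \<Lambda> p12 by (simp add: D_def \<Lambda>_def)
  \<comment> \<open>The first bound makes label 1 the leader, the second keeps the error of the
    exponent below \<open>n * \<epsilon> / 2\<close>.\<close>
  define \<eta> where "\<eta> = min ((p 1 - p 2) / 2) (\<epsilon> / (4 * \<Lambda>))"
  have \<eta>: "\<eta> > 0" "2 * \<eta> \<le> p 1 - p 2" "2 * \<eta> * \<Lambda> \<le> \<epsilon> / 2"
  proof -
    show "\<eta> > 0" using p12 \<epsilon> \<Lambda> by (simp add: \<eta>_def)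
    show "2 * \<eta> \<le> p 1 - p 2" by (simp add: \<eta>_def min_def)
    have "\<eta> \<le> \<epsilon> / (4 * \<Lambda>)" by (simp add: \<eta>_def)
    then show "2 * \<eta> * \<Lambda> \<le> \<epsilon> / 2" using \<Lambda> by (simp add: field_simps)
  qed
  obtain n0 where n0: "\<And>n. n \<ge> n0 \<Longrightarrow> 2 * real K \<le> exp (\<epsilon> / 2 * real n)"
    using exp_linear_eventually_ge[of "\<epsilon> / 2" "2 * real K"] \<epsilon> by auto
  have "1 - exp (- real n * (D - \<epsilon>)) \<le> agg_posterior K p L n (top_counts \<omega> n) \<and>
        agg_posterior K p L n (top_counts \<omega> n) \<le> 1 - exp (- real n * (D + \<epsilon>))"
    if "answer_sample K p \<omega> n" "n \<ge> n0" and tp: "\<omega> \<notin> deviation K p \<eta> n" for \<omega> n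
  proof -
    interpret answer_sample K p \<omega> n by fact
    define g where "g = cs ! 0 - second_count \<omega> n"
    have t: "\<bar>real (cs ! 0) - real n * p 1\<bar> < \<eta> * real n"
      "\<bar>real (second_count \<omega> n) - real n * p 2\<bar> < \<eta> * real n"
      using typical_counts[OF tp \<eta>(2)] .
    have "second_count \<omega> n \<le> cs ! 0"
      by (auto simp: second_count_def intro!: top_counts_decr)
    then have "real g = real (cs ! 0) - real (second_count \<omega> n)" by (simp add: g_def)
    then have g: "\<bar>real g - real n * (p 1 - p 2)\<bar> \<le> 2 * \<eta> * real n"
      using t by (simp add: algebra_simps)
    have "real g * \<Lambda> - real n * D = (real g - real n * (p 1 - p 2)) * \<Lambda>"
      unfolding D_def \<Lambda>_def by (simp add: algebra_simps)
    then have "\<bar>real g * \<Lambda> - real n * D\<bar> = \<bar>real g - real n * (p 1 - p 2)\<bar> * \<Lambda>"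
      using \<Lambda> by (simp add: abs_mult)
    also have "\<dots> \<le> 2 * \<eta> * real n * \<Lambda>" using g \<Lambda> by (intro mult_right_mono) auto
    also have "\<dots> = real n * (2 * \<eta> * \<Lambda>)" by simp
    also have "\<dots> \<le> real n * (\<epsilon> / 2)" using \<eta>(3) by (intro mult_left_mono) auto
    finally have gd: "\<bar>real g * \<Lambda> - real n * D\<bar> \<le> real n * (\<epsilon> / 2)" .
    have y: "(p 2 / p 1) ^ g = exp (- (real g * \<Lambda>))"
    proof -
      have "p 2 / p 1 = exp (- \<Lambda>)" using p1_pos p2_pos by (simp add: \<Lambda>_def exp_minus)
      then show ?thesis by (simp add: exp_of_nat_mult[symmetric])
    qed
    have K1: "real K \<ge> 1" using K2 by simp
    show ?thesis
    proof (intro conjI)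
      have a: "1 - real K * (p 2 / p 1) ^ g \<le> agg_posterior K p L n cs"
        using posterior_bounds_ge_3(1)[OF L] by (simp add: g_def)
      have "agg_posterior K p L n cs \<le> 1 - (p 2 / p 1) ^ g / (2 * real K)"
        using posterior_bounds_ge_3(2)[OF L] by (simp add: g_def)
      also have "\<dots> \<le> 1 - min 1 ((p 2 / p 1) ^ g / real K) / 2" by (simp add: min_def mult.commute)
      finally have b: "agg_posterior K p L n cs \<le> 1 - min 1 ((p 2 / p 1) ^ g / real K) / 2" .
      have c: "exp (- real n * (D + \<epsilon> / 2)) \<le> (p 2 / p 1) ^ g" "(p 2 / p 1) ^ g \<le> exp (- real n * (D - \<epsilon> / 2))"
        unfolding y exp_le_cancel_iff using gd unfolding abs_le_iff by (auto simp: algebra_simps)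
      show "1 - exp (- real n * (D - \<epsilon>)) \<le> agg_posterior K p L n cs"
        "agg_posterior K p L n cs \<le> 1 - exp (- real n * (D + \<epsilon>))"
        using rate_bounds[OF a b c K1 n0[OF \<open>n \<ge> n0\<close>] D0 \<epsilon>] .
    qed
  qed
  then show ?thesis using \<eta>(1) by blast
qed

text \<open>Given that the answer is not \<open>i\<close>, label \<open>j\<close> has probability
  \<open>q = p j / (1 - p i)\<close>, so its mean count is near \<open>q * (1 - p 1) * n\<close>.
  This lies below the cap \<open>v\<close>, near \<open>p 1 * n\<close>, by a margin
  \<open>\<kappa> * n\<close>; Chernoff's bound makes overflow exponentially rare, so the cap costs
  at most half of the uncapped sum.\<close>

lemma free_sum_typical:
  fixes n v :: nat and \<kappa> \<eta> :: real
  defines "\<kappa> \<equiv> p 1 * (p 1 - p 2)"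
  assumes v: "\<bar>real v - real n * p 1\<bar> < \<eta> * real n" "v \<le> n" and \<eta>: "\<eta> \<le> \<kappa> / 4"
    and n: "2 * real K \<le> exp ((\<kappa> / 4)\<^sup>2 * real n)" and i: "i \<in> {1, 2}"
  shows "(1 - p i) ^ (n - v) \<le> 2 * real K * free_sum p 1 v (n - v) ({1..K} - {i})"
proof -
  define N where "N = n - v"
  define J where "J = {1..K} - {i}"
  define s where "s = 1 - p i"
  \<comment> \<open>The tilt is \<open>\<theta> = 1 + t\<close>. A quarter of the margin suffices
    because the errors from \<open>\<eta>\<close> (twice) and from \<open>ln (1 + t)\<close> use at
    most three quarters.\<close>
  define t where "t = \<kappa> / 4"
  have \<kappa>: "\<kappa> > 0" using p1_pos p12 by (simp add: \<kappa>_def)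
  then have t: "t > 0" by (simp add: t_def)
  have iK: "i \<in> {1..K}" using i K2 by auto
  have s: "s > 0" using p1_lt_1 p12 i by (auto simp: s_def)
  have J: "finite J" "\<And>j. j \<in> J \<Longrightarrow> p j > 0" "card J = K - 1" "(\<Sum>j\<in>J. p j) = s"
    using p_pos iK sum_without[OF iK] by (auto simp: J_def s_def)
  have term_le: "(s + (1 + t - 1) * p j) ^ N / (1 + t) ^ v \<le> s ^ N * exp (- (t\<^sup>2 * real n))" if j: "j \<in> J" for j
  proof -
    define q where "q = p j / s"
    have "p j \<le> s" using member_le_sum[of j J p] J j less_imp_le by auto
    then have q: "0 \<le> q" "q \<le> 1" using s J(2)[OF j] by (auto simp: q_def)
    \<comment> \<open>For \<open>i = 1\<close> the worst competitor is label 2; for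
      \<open>i = 2\<close> it is label 1, where \<open>p 1 * (1 - p 1) / (1 - p 2)\<close> is still
      below \<open>p 1\<close> because \<open>p 1 > p 2\<close>. The margin \<open>\<kappa>\<close>
      serves both cases.\<close>
    have qk: "q * (1 - p 1) \<le> p 1 - \<kappa>"
    proof (cases "i = 1")
      case True
      then have "q * (1 - p 1) = p j" using s by (simp add: q_def s_def)
      also have "\<dots> \<le> p 2" using j True by (intro p_le_p2) (auto simp: J_def)
      also have "\<dots> \<le> p 1 - \<kappa>"
      proof -
        have "p 1 * (p 1 - p 2) \<le> 1 * (p 1 - p 2)" using p1_lt_1 p12 by (intro mult_right_mono) auto
        then have "\<kappa> \<le> p 1 - p 2" unfolding \<kappa>_def mult_1 .
        then show ?thesis by linarith
      qed
      finally show ?thesis .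
    next
      case False
      then have i2: "i = 2" using i by simp
      have "p j \<le> p 1"
        using j p_le_p2[of j] p12 by (cases "j = 1") (auto simp: J_def)
      then have "p j * (1 - p 1) \<le> p 1 * (1 - p 1)" using p1_lt_1 by (intro mult_right_mono) auto
      also have "\<dots> \<le> p 1 * (1 - p 1 + p 2 * (p 1 - p 2))"
        using p1_pos p2_pos p12 by (intro mult_left_mono) auto
      also have "\<dots> = (p 1 - \<kappa>) * s" by (simp add: \<kappa>_def s_def i2 algebra_simps)
      finally show ?thesis using s by (simp add: q_def pos_divide_le_eq)
    qed
    have expo: "t * (q * real N) - real v * (1 - 1 / (1 + t)) \<le> - (t\<^sup>2 * real n)"
    proof -
      have "q * real N = q * (1 - p 1) * real n + q * (real n * p 1 - real v)"
        using v(2) by (simp add: N_def algebra_simps)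
      also have "\<dots> \<le> (p 1 - \<kappa>) * real n + 1 * (\<eta> * real n)"
      proof (intro add_mono mult_right_mono qk)
        have "q * (real n * p 1 - real v) \<le> q * (\<eta> * real n)"
          using v(1) q by (intro mult_left_mono) auto
        also have "\<dots> \<le> 1 * (\<eta> * real n)" using v(1) q by (intro mult_right_mono) auto
        finally show "q * (real n * p 1 - real v) \<le> 1 * (\<eta> * real n)" .
      qed simp
      also have "\<dots> = real n * p 1 - 4 * (real n * t) + \<eta> * real n"
        by (simp add: t_def algebra_simps)
      finally have 1: "q * real N \<le> real n * p 1 - 4 * (real n * t) + \<eta> * real n" .
      have "real v * t \<le> real n * t" using v(2) t by (intro mult_right_mono) auto
      moreover have "\<eta> * real n \<le> real n * t" 
        using mult_right_mono[of \<eta> t "real n"] \<eta> by (simp add: t_def mult.commute)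
      moreover have "real v > real n * p 1 - \<eta> * real n" using v(1) by auto
      ultimately have "q * real N - real v + real v * t \<le> - (real n * t)"
        using 1 by linarith
      then have "t * (q * real N - real v + real v * t) \<le> t * (- (real n * t))"
        using t by (intro mult_left_mono) auto
      \<comment> \<open>\<open>1 - 1 / (1 + t)\<close> stands in for \<open>ln (1 + t)\<close>; it
        is at least \<open>t - t^2\<close>.\<close>
      moreover have "real v * (t - t * t) \<le> real v * (1 - 1 / (1 + t))"
      proof (intro mult_left_mono)
        have "(t - t * t) * (1 + t) \<le> t" using t by (simp add: algebra_simps)
        then show "t - t * t \<le> 1 - 1 / (1 + t)" using t by (simp add: field_simps)
      qed simp
      ultimately show ?thesis by (simp add: algebra_simps power2_eq_square)
    qed
    have "(s + (1 + t - 1) * p j) ^ N = s ^ N * (1 + t * q) ^ N"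
      using s by (simp add: q_def distrib_left flip: power_mult_distrib)
    also have "\<dots> \<le> s ^ N * exp (t * q) ^ N"
      using s t q by (intro mult_left_mono power_mono) auto
    also have "exp (t * q) ^ N = exp (t * (q * real N))" by (simp add: mult_ac flip: exp_of_nat_mult)
    finally have num: "(s + (1 + t - 1) * p j) ^ N \<le> s ^ N * exp (t * (q * real N))" .
    have "exp (1 - 1 / (1 + t)) \<le> 1 + t"
    proof -
      have "1 / (1 + t) \<le> exp (- (1 - 1 / (1 + t)))"
        using exp_ge_add_one_self[of "- (1 - 1 / (1 + t))"] by simp
      then show ?thesis using t by (simp add: exp_minus field_simps)
    qed
    then have "exp (1 - 1 / (1 + t)) ^ v \<le> (1 + t) ^ v" by (intro power_mono) auto
    then have den: "exp (real v * (1 - 1 / (1 + t))) \<le> (1 + t) ^ v" by (simp add: exp_of_nat_mult)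
    have "(s + (1 + t - 1) * p j) ^ N / (1 + t) ^ v
        \<le> s ^ N * exp (t * (q * real N)) / exp (real v * (1 - 1 / (1 + t)))"
      using num den s t by (intro frac_le) auto
    also have "\<dots> = s ^ N * exp (t * (q * real N) - real v * (1 - 1 / (1 + t)))"
      by (simp add: exp_diff)
    also have "\<dots> \<le> s ^ N * exp (- (t\<^sup>2 * real n))"
      using expo s by (intro mult_left_mono) auto
    finally show ?thesis .
  qed
  \<comment> \<open>Summed over fewer than \<open>K\<close> labels, the overflow terms take away at
    most half of \<open>s ^ N\<close>.\<close>
  have small: "real K * exp (- (t\<^sup>2 * real n)) \<le> 1 / 2"
    using n by (simp add: t_def exp_minus field_simps)
  have "(\<Sum>j\<in>J. (s + (1 + t - 1) * p j) ^ N / (1 + t) ^ v) \<le> (\<Sum>j\<in>J. s ^ N * exp (- (t\<^sup>2 * real n)))"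
    by (intro sum_mono term_le)
  also have "\<dots> \<le> real K * (s ^ N * exp (- (t\<^sup>2 * real n)))"
    using s J(3) by (auto intro!: mult_right_mono)
  also have "\<dots> = s ^ N * (real K * exp (- (t\<^sup>2 * real n)))" by simp
  also have "\<dots> \<le> s ^ N * (1 / 2)" using s by (intro mult_left_mono small) auto
  finally have "(\<Sum>j\<in>J. (s + (1 + t - 1) * p j) ^ N / (1 + t) ^ v) \<le> s ^ N / 2" by simp
  moreover have "real (Suc (card J)) * free_sum p 1 v N J \<ge>
      s ^ N - (\<Sum>j\<in>J. (s + (1 + t - 1) * p j) ^ N / (1 + t) ^ v)"
    unfolding J(4)[symmetric] using t J(1,2) by (intro free_sum_ge) auto
  moreover have "Suc (card J) = K" using J(3) K2 by simp
  ultimately have "s ^ N \<le> 2 * (real K * free_sum p 1 v N J)" by simp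
  then show ?thesis by (simp add: s_def N_def J_def)
qed

text \<open>Gibbs' inequality: apply \<open>ln x \<le> x - 1\<close> to both likelihood ratios; it
  is strict for the first since \<open>p 2 / p 1\<close> differs from 1.\<close>

lemma KL_bern_pos: "KL_bern (p 1) (p 2) > 0"
proof -
  have q: "0 < 1 - p 1" "0 < 1 - p 2" using p1_lt_1 p12 by auto
  have "ln (p 2 / p 1) < p 2 / p 1 - 1"
    using ln_le_minus_one[of "p 2 / p 1"] ln_eq_minus_one[of "p 2 / p 1"] p1_pos p2_pos p12 by force
  then have 1: "p 1 * ln (p 2 / p 1) < p 1 * (p 2 / p 1 - 1)" using p1_pos by (intro mult_strict_left_mono)
  have "ln ((1 - p 2) / (1 - p 1)) \<le> (1 - p 2) / (1 - p 1) - 1" using q by (intro ln_le_minus_one) simp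
  then have 2: "(1 - p 1) * ln ((1 - p 2) / (1 - p 1)) \<le> (1 - p 1) * ((1 - p 2) / (1 - p 1) - 1)"
    using q by (intro mult_left_mono) auto
  have "p 1 * (p 2 / p 1 - 1) + (1 - p 1) * ((1 - p 2) / (1 - p 1) - 1) = 0"
    using p1_pos q by (simp add: field_simps)
  moreover have "KL_bern (p 1) (p 2) = - (p 1 * ln (p 2 / p 1) + (1 - p 1) * ln ((1 - p 2) / (1 - p 1)))"
    using p1_pos p2_pos q by (simp add: KL_bern_def ln_div algebra_simps)
  ultimately show ?thesis using 1 2 by linarith
qed

text \<open>The log-likelihood ratio of labels 1 and 2 is affine in the largest count
  \<open>v\<close>, with the log odds ratio \<open>\<Lambda>\<close> as slope, and equals
  \<open>n * D\<close> at \<open>v = n * p 1\<close>.\<close>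

lemma typical_2:
  assumes \<epsilon>: "\<epsilon> > 0"
  defines "D \<equiv> KL_bern (p 1) (p 2)"
  shows "\<exists>\<eta>>0. \<exists>n0. \<forall>\<omega> n. answer_sample K p \<omega> n \<longrightarrow> n \<ge> n0 \<longrightarrow> \<omega> \<notin> deviation K p \<eta> n \<longrightarrow>
        1 - exp (- real n * (D - \<epsilon>)) \<le> agg_posterior K p 2 n (top_counts \<omega> n) \<and>
        agg_posterior K p 2 n (top_counts \<omega> n) \<le> 1 - exp (- real n * (D + \<epsilon>))"
proof -
  define \<kappa> where "\<kappa> = p 1 * (p 1 - p 2)"
  have \<kappa>: "\<kappa> > 0" using p1_pos p12 by (simp add: \<kappa>_def)
  have q: "0 < 1 - p 1" "0 < 1 - p 2" using p1_lt_1 p12 by auto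
  define \<Lambda> where "\<Lambda> = ln (p 1 / p 2) + ln ((1 - p 2) / (1 - p 1))"
  have \<Lambda>: "\<Lambda> > 0" using p12 p2_pos q by (auto simp: \<Lambda>_def intro!: add_pos_pos)
  \<comment> \<open>The three bounds serve, in order, the leadership of label 1, the Chernoff
    estimate, and an error of at most \<open>\<epsilon> / 2\<close> in the rate.\<close>
  define \<eta> where "\<eta> = min ((p 1 - p 2) / 2) (min (\<kappa> / 4) (\<epsilon> / (2 * \<Lambda>)))"
  have \<eta>: "\<eta> > 0" "2 * \<eta> \<le> p 1 - p 2" "\<eta> \<le> \<kappa> / 4" "\<eta> * \<Lambda> \<le> \<epsilon> / 2"
  proof -
    show "\<eta> > 0" using p12 \<epsilon> \<Lambda> \<kappa> by (simp add: \<eta>_def)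
    show "2 * \<eta> \<le> p 1 - p 2" "\<eta> \<le> \<kappa> / 4" by (simp_all add: \<eta>_def min_def)
    have "\<eta> \<le> \<epsilon> / (2 * \<Lambda>)" by (simp add: \<eta>_def)
    then show "\<eta> * \<Lambda> \<le> \<epsilon> / 2" using \<Lambda> by (simp add: field_simps)
  qed
  \<comment> \<open>One factor \<open>K\<close> comes from summing over the wrong labels, the factor
    \<open>2 * K\<close> from removing cap and tie weights in
    \<open>free_sum_typical\<close>.\<close>
  define C where "C = real K * (2 * real K)"
  have K1: "real K \<ge> 1" using K2 by simp
  have C: "C \<ge> 1" "2 * real K \<le> C"
    using K1 mult_mono[of 1 "real K" 1 "2 * real K"] mult_right_mono[of 1 "real K" "2 * real K"]
    by (auto simp: C_def)
  obtain m1 where m1: "\<And>n. n \<ge> m1 \<Longrightarrow> 2 * C \<le> exp (\<epsilon> / 2 * real n)"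
    using exp_linear_eventually_ge[of "\<epsilon> / 2" "2 * C"] \<epsilon> by auto
  obtain n2 where n2: "\<And>n. n \<ge> n2 \<Longrightarrow> 2 * real K \<le> exp ((\<kappa> / 4)\<^sup>2 * real n)"
    using exp_linear_eventually_ge[of "(\<kappa> / 4)\<^sup>2" "2 * real K"] \<kappa> by auto
  have "1 - exp (- real n * (D - \<epsilon>)) \<le> agg_posterior K p 2 n (top_counts \<omega> n) \<and>
        agg_posterior K p 2 n (top_counts \<omega> n) \<le> 1 - exp (- real n * (D + \<epsilon>))"
    if "answer_sample K p \<omega> n" "n \<ge> max m1 n2" and tp: "\<omega> \<notin> deviation K p \<eta> n" for \<omega> n
  proof -
    interpret answer_sample K p \<omega> n by fact
    define v where "v = cs ! 0"
    have t: "\<bar>real v - real n * p 1\<bar> < \<eta> * real n"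
      unfolding v_def using typical_counts(1)[OF tp \<eta>(2)] .
    have vn: "v \<le> n" using cs_0_le by (simp add: v_def)
    have fs: "(1 - p i) ^ (n - cs ! 0) \<le> 2 * real K * free_sum p 1 (cs ! 0) (n - cs ! 0) ({1..K} - {i})"
      if "i \<in> {1, 2}" for i
      using free_sum_typical[OF t vn, folded \<kappa>_def] \<eta>(3) n2[of n] \<open>n \<ge> max m1 n2\<close> that by (simp add: v_def)
    define y where "y = lik 2 / lik 1"
    have y: "y = exp (- (real v * \<Lambda> - real n * ln ((1 - p 2) / (1 - p 1))))"
    proof -
      have pw: "a ^ k = exp (real k * ln a)" if "a > 0" for a :: real and k
        using that by (simp add: exp_of_nat_mult)
      have "y = exp (real v * ln (p 2) + real (n - v) * ln (1 - p 2) - (real v * ln (p 1) + real (n - v) * ln (1 - p 1)))"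
        unfolding y_def lik_def v_def[symmetric] exp_diff exp_add
        using pw[OF p1_pos] pw[OF p2_pos] pw[OF q(1)] pw[OF q(2)] by simp
      also have "\<dots> = exp (- (real v * \<Lambda> - real n * ln ((1 - p 2) / (1 - p 1))))"
        using vn p1_pos p2_pos q by (simp add: \<Lambda>_def ln_div algebra_simps of_nat_diff)
      finally show ?thesis .
    qed
    have D: "D = p 1 * \<Lambda> - ln ((1 - p 2) / (1 - p 1))"
      using p1_pos p2_pos q by (simp add: D_def KL_bern_def \<Lambda>_def ln_div algebra_simps)
    have "\<bar>real v * \<Lambda> - real n * ln ((1 - p 2) / (1 - p 1)) - real n * D\<bar> = \<bar>(real v - real n * p 1) * \<Lambda>\<bar>"
      by (simp add: D algebra_simps)
    also have "\<dots> = \<bar>real v - real n * p 1\<bar> * \<Lambda>"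
      using \<Lambda> by (simp add: abs_mult)
    also have "\<dots> \<le> \<eta> * real n * \<Lambda>" using t \<Lambda> by (intro mult_right_mono) auto
    also have "\<dots> = real n * (\<eta> * \<Lambda>)" by simp
    also have "\<dots> \<le> real n * (\<epsilon> / 2)" using \<eta>(4) by (intro mult_left_mono) auto
    finally have d: "\<bar>real v * \<Lambda> - real n * ln ((1 - p 2) / (1 - p 1)) - real n * D\<bar> \<le> real n * (\<epsilon> / 2)" .
    have c: "exp (- real n * (D + \<epsilon> / 2)) \<le> y" "y \<le> exp (- real n * (D - \<epsilon> / 2))"
      unfolding y exp_le_cancel_iff using d unfolding abs_le_iff by (auto simp: algebra_simps)
    have y0: "y \<ge> 0" by (simp add: y)
    have a: "1 - C * y \<le> agg_posterior K p 2 n cs"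
      using posterior_bounds_2(1)[OF fs] K1 by (simp add: C_def y_def)
    have "agg_posterior K p 2 n cs \<le> 1 - min 1 (lik 2 / (2 * real K * lik 1)) / 2"
      using posterior_bounds_2(2)[OF fs] K1 by simp
    also have "lik 2 / (2 * real K * lik 1) = y / (2 * real K)" by (simp add: y_def)
    also have "1 - min 1 (y / (2 * real K)) / 2 \<le> 1 - min 1 (y / C) / 2"
    proof -
      have "y / C \<le> y / (2 * real K)" using C K1 y0 by (intro divide_left_mono) auto
      then show ?thesis by (simp add: min_def)
    qed
    finally have b: "agg_posterior K p 2 n cs \<le> 1 - min 1 (y / C) / 2" .
    have D0: "D \<ge> 0" using KL_bern_pos by (simp add: D_def)
    show ?thesis
      using rate_bounds[OF a b c C(1) m1 D0 \<epsilon>] \<open>n \<ge> max m1 n2\<close> by auto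
  qed
  then show ?thesis using \<eta>(1) by blast
qed

end

theorem theorem1:
  fixes K :: nat and p :: "nat \<Rightarrow> real"
  assumes "K \<ge> 2"
    and "p 1 > p 2"
    and "\<forall>i j. 2 \<le> i \<longrightarrow> i \<le> j \<longrightarrow> j \<le> K \<longrightarrow> p j \<le> p i"
    and "p K > 0"
    and "(\<Sum>k=1..K. p k) = 1"
  shows "((\<lambda>\<delta>. expected_stop K p 2 \<delta> / ennreal (ln (1 / \<delta>)))
            \<longlongrightarrow> ennreal (1 / KL_bern (p 1) (p 2))) (at_right 0)
         \<and> (\<forall>L\<in>{3..K}. ((\<lambda>\<delta>. expected_stop K p L \<delta> / ennreal (ln (1 / \<delta>)))
            \<longlongrightarrow> ennreal (1 / ((p 1 - p 2) * ln (p 1 / p 2)))) (at_right 0))"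
proof -
  interpret answer_model K p
    using assms by unfold_locales auto
  have "(p 1 - p 2) * ln (p 1 / p 2) > 0" using p12 p2_pos by simp
  then show ?thesis
    using stop_time_limit[OF _ KL_bern_pos typical_2] stop_time_limit[OF _ _ typical_ge_3] by simp
qed

end
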